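(* There is a subgroup $F$ of $\overline{\phi}(\mathcal{B})\cap\mathrm{PGL}(2,\mathbb{Z}[t,t^{-1}])$ such that the group $\overline{\Gamma}=\Gamma/Z(\Gamma)$ is isomorphic to a semidirect product $F\rtimes\mathrm{PSL}(2,\mathbb{Z})$.
   Context: For a matrix $A$ with Laurent polynomial entries, $\overline{A}$ denotes the matrix obtained by substituting $t\mapsto t^{-1}$ in every entry. Let $J_3=\begin{pmatrix}1&-t^{-1}&-t^{-1}\\-t&1&-t^{-1}\\-t&-t&1\end{pmatrix}$, $v=(t,t^2,t^3)$ (a row vector) and $\vec{1}=(1,1,1)^T$. The formal Burau group is $\mathcal{B}=\{A\in\mathrm{GL}(3,\mathbb{Z}[t,t^{-1}]) : vA=v,\ A\vec 1=\vec 1,\ \overline{A}J_3A^T=J_3\}$, and Salter's group is $\Gamma=\{A\in\mathcal{B}: A|_{t=1}\text{ is a }3\times3\text{ permutation matrix}\}$, with center $Z(\Gamma)$. For $A=(A_{ij})\in\mathcal{B}$ put, for $k=1,2$, $f_{k1}=A_{k1}(1+t+t^2)-1$, $f_{k2}=A_{k1}+A_{k2}(1+t)-1$, and $g_{kl}=f_{kl}/(t(1+t))$. Define $\phi(A)=\begin{pmatrix}g_{11}&g_{12}\\ t^{-1}g_{11}+(1+t)g_{21}& t^{-1}g_{12}+(1+t)g_{22}\end{pmatrix}\in\mathrm{GL}(2,\mathbb{Q}(t))$, and $\overline{\phi}=\pi\circ\phi$, where $\pi:\mathrm{GL}(2,\mathbb{Q}(t))\to\mathrm{PGL}(2,\mathbb{Q}(t))$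 is the projection. $\mathrm{PGL}(2,\mathbb{Z}[t,t^{-1}])$ is regarded as the image of $\mathrm{GL}(2,\mathbb{Z}[t,t^{-1}])$ under $\pi$. *)

theory Defs
  imports "HOL-Analysis.Analysis" "HOL-Computational_Algebra.Formal_Laurent_Series"
          "HOL-Algebra.Coset"
begin

section \<open>Laurent polynomials inside Q((t))\<close>

type_synonym K = "rat fls"  \<comment> \<open>ambient field Q((t)), containing Q(t) and Z[t,t^-1]\<close>

abbreviation tt :: K where "tt \<equiv> fls_X"
abbreviation tinv :: K where "tinv \<equiv> fls_X_inv"

definition LP :: "K set" where
  "LP = {f. finite {n. fls_nth f n \<noteq> 0} \<and> (\<forall>n. fls_nth f n \<in> \<int>)}"

text \<open>bar: substitution t to t^-1 (on Laurent polynomials)\<close>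
definition lbar :: "K \<Rightarrow> K" where
  "lbar f = (\<Sum>n | fls_nth f n \<noteq> 0. fls_const (fls_nth f n) * fls_X_intpow (-n))"

text \<open>evaluation at t = 1 (on Laurent polynomials)\<close>
definition ev1 :: "K \<Rightarrow> rat" where
  "ev1 f = (\<Sum>n | fls_nth f n \<noteq> 0. fls_nth f n)"

definition mbar :: "K^'n^'m \<Rightarrow> K^'n^'m" where
  "mbar A = (\<chi> i j. lbar (A$i$j))"

definition GL_LP :: "K^'n^'n \<Rightarrow> bool" where
  "GL_LP A \<longleftrightarrow> (\<forall>i j. A$i$j \<in> LP) \<and>
     (\<exists>B. (\<forall>i j. B$i$j \<in> LP) \<and> A ** B = mat 1 \<and> B ** A = mat 1)"

definition J3 :: "K^3^3" where
  "J3 = vector [vector [1, - tinv, - tinv], vector [- tt, 1, - tinv], vector [- tt, - tt, 1]]"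

definition vB :: "K^3" where "vB = vector [tt, tt^2, tt^3]"
definition ones3 :: "K^3" where "ones3 = vector [1, 1, 1]"

definition Burau :: "(K^3^3) set" where
  "Burau = {A. GL_LP A \<and> vB v* A = vB \<and> A *v ones3 = ones3 \<and> mbar A ** J3 ** transpose A = J3}"

definition permutation_matrix :: "rat^'n^'n \<Rightarrow> bool" where
  "permutation_matrix M \<longleftrightarrow> (\<exists>p. p permutes (UNIV::'n set) \<and> M = (\<chi> i j. if p i = j then 1 else 0))"

definition Salter :: "(K^3^3) set" where
  "Salter = {A \<in> Burau. permutation_matrix (\<chi> i j. ev1 (A$i$j))}"

definition Salter_grp :: "(K^3^3) monoid" where
  "Salter_grp = \<lparr>carrier = Salter, mult = (**), one = mat 1\<rparr>"

definition center :: "('a, 'b) monoid_scheme \<Rightarrow> 'a set" where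
  "center G = {z \<in> carrier G. \<forall>g \<in> carrier G. z \<otimes>\<^bsub>G\<^esub> g = g \<otimes>\<^bsub>G\<^esub> z}"

section \<open>GL / PGL(2) over the field\<close>

definition GL2K :: "(K^2^2) monoid" where
  "GL2K = \<lparr>carrier = {A. invertible A}, mult = (**), one = mat 1\<rparr>"

definition scalars2 :: "(K^2^2) set" where
  "scalars2 = {mat c | c. c \<noteq> 0}"

definition PGL2K :: "(K^2^2) set monoid" where
  "PGL2K = GL2K Mod scalars2"

definition proj :: "K^2^2 \<Rightarrow> (K^2^2) set" where
  "proj A = r_coset GL2K scalars2 A"

definition PGL2_LP :: "(K^2^2) set set" where
  "PGL2_LP = {proj A | A. GL_LP A}"

definition phi :: "K^3^3 \<Rightarrow> K^2^2" where
  "phi A = (let f = (\<lambda>k::3. (A$k$1 * (1 + tt + tt^2) - 1, A$k$1 + A$k$2 * (1 + tt) - 1));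
               g = (\<lambda>k. (fst (f k) / (tt * (1 + tt)), snd (f k) / (tt * (1 + tt))));
               g11 = fst (g 1); g12 = snd (g 1); g21 = fst (g 2); g22 = snd (g 2)
           in vector [vector [g11, g12],
                      vector [tinv * g11 + (1 + tt) * g21, tinv * g12 + (1 + tt) * g22]])"

definition phibar :: "K^3^3 \<Rightarrow> (K^2^2) set" where
  "phibar A = proj (phi A)"

section \<open>PSL(2,Z)\<close>

definition SL2Z :: "(int^2^2) monoid" where
  "SL2Z = \<lparr>carrier = {A. det A = 1}, mult = (**), one = mat 1\<rparr>"

definition PSL2Z :: "(int^2^2) set monoid" where
  "PSL2Z = SL2Z Mod {mat 1, - mat 1}"

section \<open>External semidirect product N \<rtimes>_\<theta> H\<close>

definition semidirect_action :: "('a, 'c) monoid_scheme \<Rightarrow> ('b, 'd) monoid_scheme \<Rightarrow> ('b \<Rightarrow> 'a \<Rightarrow> 'a) \<Rightarrow> bool" where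
  "semidirect_action N H \<theta> \<longleftrightarrow> group N \<and> group H \<and>
     (\<forall>h \<in> carrier H. \<theta> h \<in> iso N N) \<and>
     (\<forall>h1 \<in> carrier H. \<forall>h2 \<in> carrier H. \<forall>n \<in> carrier N.
        \<theta> (h1 \<otimes>\<^bsub>H\<^esub> h2) n = \<theta> h1 (\<theta> h2 n))"

definition semidirect_product :: "('a, 'c) monoid_scheme \<Rightarrow> ('b, 'd) monoid_scheme \<Rightarrow> ('b \<Rightarrow> 'a \<Rightarrow> 'a) \<Rightarrow> ('a \<times> 'b) monoid" where
  "semidirect_product N H \<theta> =
     \<lparr>carrier = carrier N \<times> carrier H,
      mult = (\<lambda>(n1, h1) (n2, h2). (n1 \<otimes>\<^bsub>N\<^esub> \<theta> h1 n2, h1 \<otimes>\<^bsub>H\<^esub> h2)),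
      one = (\<one>\<^bsub>N\<^esub>, \<one>\<^bsub>H\<^esub>)\<rparr>"

end

theory Submission
  imports Defs "HOL-Algebra.Generated_Groups"
begin

text \<open>An element \<open>A\<close> of the formal Burau group is determined by its restriction to the kernel of the row
  vector \<open>v\<close>, and \<open>\<phi>(A)\<close> is the matrix of this restriction; the Burau generators force the center of
  \<open>\<Gamma>\<close> to be the set of \<open>A\<close> with \<open>\<phi>(A)\<close> scalar, so \<open>\<Gamma>/Z(\<Gamma>)\<close> embeds into \<open>PGL(2)\<close>. Acting on row
  vectors of coordinate sum zero and setting \<open>t = -1\<close> gives integer matrices. The Hermitian form,
  divided by \<open>1 + t\<close>, becomes symplectic at \<open>t = -1\<close>, so these matrices lie in \<open>SL(2,\<int>)\<close>; this yields
  \<open>\<Gamma> \<rightarrow> PSL(2,\<int>)\<close>, and \<open>F\<close> is the image of its kernel. For \<open>A\<close> in the kernel the entry \<open>A\<^sub>1\<^sub>1\<close> is \<open>1\<close> at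
  \<open>t = -1\<close>, which cancels the denominators \<open>1 + t\<close> of \<open>\<phi>(A)\<close>. The complement is the image of the
  braid group on three strands: modulo the center it is generated by an involution \<open>a\<close> and an element
  \<open>c\<close> of order three, and the normal form of words in \<open>a\<close> and \<open>c\<close> shows that it maps isomorphically
  onto \<open>PSL(2,\<int>)\<close>.\<close>

section \<open>Laurent polynomials and their evaluations\<close>

abbreviation lmonom :: "rat \<Rightarrow> int \<Rightarrow> K" where
  "lmonom c n \<equiv> fls_const c * fls_X_intpow n"

lemma lmonom_nth: "fls_nth (lmonom c n) m = (if m = n then c else 0)"
  by (auto simp: fls_times_conv_regpart fls_X_intpow_times_conv_shift)

lemma lmonom_mult: "lmonom c n * lmonom d m = lmonom (c * d) (n + m)"
proof -
  have "lmonom c n * lmonom d m = (fls_const c * fls_const d) * (fls_X_intpow n * fls_X_intpow m)"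
    by (simp only: mult_ac)
  then show ?thesis
    by (simp only: fls_const_mult_const fls_X_intpow_times_fls_X_intpow)
qed

lemma LP_nth_Ints: "f \<in> LP \<Longrightarrow> fls_nth f n \<in> \<int>"
  by (simp add: LP_def)

lemma LP_finite: "f \<in> LP \<Longrightarrow> finite {n. fls_nth f n \<noteq> 0}"
  by (simp add: LP_def)

lemma LP_0: "0 \<in> LP"
  by (simp add: LP_def)

lemma LP_lmonom: "c \<in> \<int> \<Longrightarrow> lmonom c n \<in> LP"
  unfolding LP_def lmonom_nth by (auto intro: finite_subset[of _ "{n}"])

lemma LP_add: assumes "f \<in> LP" "g \<in> LP" shows "f + g \<in> LP"
proof -
  have "{n. fls_nth (f + g) n \<noteq> 0} \<subseteq> {n. fls_nth f n \<noteq> 0} \<union> {n. fls_nth g n \<noteq> 0}" by auto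
  then show ?thesis using assms by (auto simp: LP_def intro: finite_subset)
qed

lemma LP_uminus: "f \<in> LP \<Longrightarrow> - f \<in> LP"
  by (simp add: LP_def)

lemma LP_diff: "f \<in> LP \<Longrightarrow> g \<in> LP \<Longrightarrow> f - g \<in> LP"
  using LP_add[of f "- g"] LP_uminus[of g] by simp

text \<open>Removing one monomial shrinks the finite support by one and keeps the coefficients
  integral, so additive statements about \<open>LP\<close> reduce to single monomials.\<close>

lemma LP_induct [consumes 1, case_names zero monom]:
  assumes "f \<in> LP" and P0: "P 0"
    and step: "\<And>c n g. c \<in> \<int> \<Longrightarrow> g \<in> LP \<Longrightarrow> P g \<Longrightarrow> P (lmonom c n + g)"
  shows "P f"
  using assms(1)
proof (induction "card {n. fls_nth f n \<noteq> 0}" arbitrary: f)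
  case 0
  then have "f = 0" using LP_finite[OF 0(2)] by (auto intro!: fls_eqI)
  then show ?case using P0 by simp
next
  case (Suc k)
  then obtain n where n: "fls_nth f n \<noteq> 0"
    by (metis (mono_tags, lifting) Collect_empty_eq card.empty nat.distinct(1))
  define g where "g = f - lmonom (fls_nth f n) n"
  have int: "fls_nth f n \<in> \<int>" using Suc.prems by (rule LP_nth_Ints)
  have g: "g \<in> LP" unfolding g_def by (intro LP_diff LP_lmonom Suc.prems int)
  have "{m. fls_nth g m \<noteq> 0} = {m. fls_nth f m \<noteq> 0} - {n}"
    unfolding g_def fls_minus_nth lmonom_nth by auto
  then have "card {m. fls_nth g m \<noteq> 0} = k"
    using Suc.hyps(2) n LP_finite[OF Suc.prems] by simp
  then have "P g" using Suc.hyps(1) g by blast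
  moreover have "lmonom (fls_nth f n) n + g = f" by (simp add: g_def)
  ultimately show ?case using step[OF int g, of n] by simp
qed

lemma LP_mult: assumes "f \<in> LP" "g \<in> LP" shows "f * g \<in> LP"
  using assms(1)
proof (induction rule: LP_induct)
  case (monom c n f)
  from assms(2) have "lmonom c n * g \<in> LP"
  proof (induction rule: LP_induct)
    case (monom d m g)
    then show ?case
      unfolding distrib_left lmonom_mult by (intro LP_add LP_lmonom Ints_mult \<open>c \<in> \<int>\<close>)
  qed (simp add: LP_0)
  then show ?case using monom by (simp only: distrib_right LP_add)
qed (simp add: LP_0)

lemma LP_sum: "(\<And>i. i \<in> I \<Longrightarrow> f i \<in> LP) \<Longrightarrow> sum f I \<in> LP"
  by (induction I rule: infinite_finite_induct) (auto intro: LP_0 LP_add)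

lemma tt_eq_lmonom: "tt = lmonom 1 1"
  and tinv_eq_lmonom: "tinv = lmonom 1 (-1)"
  by (simp_all add: fls_X_conv_shift_1 fls_X_inv_conv_shift_1)

lemma LP_1: "1 \<in> LP" and LP_tt: "tt \<in> LP" and LP_tinv: "tinv \<in> LP"
  using LP_lmonom[of 1 0] LP_lmonom[of 1 1] LP_lmonom[of 1 "-1"]
  unfolding tt_eq_lmonom tinv_eq_lmonom by simp_all

lemma LP_power: "f \<in> LP \<Longrightarrow> f ^ n \<in> LP"
  by (induction n) (auto intro: LP_1 LP_mult)

lemmas LP_intros = LP_0 LP_1 LP_tt LP_tinv LP_add LP_diff LP_uminus LP_mult LP_power

text \<open>The homomorphism \<open>h\<close> need only be additive and multiplicative on integers: this covers
  \<open>floor\<close>, which turns evaluation at \<open>t = -1\<close> into a map to the integers.\<close>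
locale laurent_eval =
  fixes h :: "rat \<Rightarrow> 'b::comm_ring_1" and pw :: "int \<Rightarrow> 'b"
  assumes h_add: "\<And>x y. x \<in> \<int> \<Longrightarrow> y \<in> \<int> \<Longrightarrow> h (x + y) = h x + h y"
    and h_mult: "\<And>x y. x \<in> \<int> \<Longrightarrow> y \<in> \<int> \<Longrightarrow> h (x * y) = h x * h y"
    and h_1: "h 1 = 1"
    and pw_0: "pw 0 = 1"
    and pw_add: "\<And>m n. pw (m + n) = pw m * pw n"
begin

definition ev :: "K \<Rightarrow> 'b" where
  "ev f = (\<Sum>n | fls_nth f n \<noteq> 0. h (fls_nth f n) * pw n)"

lemma h_0: "h 0 = 0"
  using h_add[of 0 0] by simp

text \<open>A common finite index set lets evaluations of Laurent polynomials with different
  supports be added termwise.\<close>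

lemma ev_superset:
  assumes "finite S" "{n. fls_nth f n \<noteq> 0} \<subseteq> S"
  shows "ev f = (\<Sum>n\<in>S. h (fls_nth f n) * pw n)"
  unfolding ev_def by (rule sum.mono_neutral_left) (use assms in \<open>auto simp: h_0\<close>)

lemma ev_0: "ev 0 = 0"
  by (simp add: ev_def)

lemma ev_lmonom: "ev (lmonom c n) = h c * pw n"
  by (subst ev_superset[of "{n}"]) (auto simp: lmonom_nth)

lemma ev_1: "ev 1 = 1"
  using ev_lmonom[of 1 0] by (simp add: h_1 pw_0)

lemma ev_add: assumes "f \<in> LP" "g \<in> LP" shows "ev (f + g) = ev f + ev g"
proof -
  let ?S = "{n. fls_nth f n \<noteq> 0} \<union> {n. fls_nth g n \<noteq> 0}"
  have S: "finite ?S" using assms by (simp add: LP_finite)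
  show ?thesis
    by (subst (1 2 3) ev_superset[OF S])
      (auto simp: assms LP_nth_Ints h_add sum.distrib distrib_right)
qed

lemma ev_uminus: assumes "f \<in> LP" shows "ev (- f) = - ev f"
  using ev_add[OF assms LP_uminus[OF assms]] ev_0 by (simp add: eq_neg_iff_add_eq_0 add.commute)

lemma ev_diff: "f \<in> LP \<Longrightarrow> g \<in> LP \<Longrightarrow> ev (f - g) = ev f - ev g"
  using ev_add[of f "- g"] ev_uminus[of g] LP_uminus[of g] by simp

text \<open>Both sides are additive in each factor, so two nested inductions leave only products of
  monomials.\<close>

lemma ev_mult: assumes "f \<in> LP" "g \<in> LP" shows "ev (f * g) = ev f * ev g"
  using assms(1)
proof (induction rule: LP_induct)
  case (monom c n f)
  from assms(2) have *: "ev (lmonom c n * g) = ev (lmonom c n) * ev g"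
  proof (induction rule: LP_induct)
    case (monom d m g)
    have "ev (lmonom c n * (lmonom d m + g)) = ev (lmonom (c * d) (n + m)) + ev (lmonom c n * g)"
      unfolding distrib_left lmonom_mult
      by (intro ev_add LP_lmonom LP_mult Ints_mult monom \<open>c \<in> \<int>\<close>)
    also have "\<dots> = ev (lmonom c n) * (ev (lmonom d m) + ev g)"
      using monom \<open>c \<in> \<int>\<close> by (simp only: ev_lmonom h_mult pw_add distrib_left mult_ac)
    also have "\<dots> = ev (lmonom c n) * ev (lmonom d m + g)"
      by (simp only: ev_add LP_lmonom monom)
    finally show ?case .
  qed (simp add: ev_0)
  have "ev ((lmonom c n + f) * g) = ev (lmonom c n * g) + ev (f * g)"
    unfolding distrib_right by (intro ev_add LP_mult LP_lmonom monom assms)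
  also have "\<dots> = ev (lmonom c n + f) * ev g"
    by (simp only: * monom ev_add LP_lmonom distrib_right)
  finally show ?case .
qed (simp add: ev_0)

lemma ev_sum: "(\<And>i. i \<in> I \<Longrightarrow> f i \<in> LP) \<Longrightarrow> ev (sum f I) = (\<Sum>i\<in>I. ev (f i))"
  by (induction I rule: infinite_finite_induct) (auto simp: ev_0 ev_add LP_sum)

lemma ev_tt: "ev tt = pw 1" and ev_tinv: "ev tinv = pw (-1)"
  using ev_lmonom[of 1 1] ev_lmonom[of 1 "-1"]
  unfolding tt_eq_lmonom tinv_eq_lmonom h_1 mult_1_left .

lemma ev_power: "f \<in> LP \<Longrightarrow> ev (f ^ n) = ev f ^ n"
  by (induction n) (auto simp: ev_1 ev_mult LP_power)

lemmas ev_simps = ev_0 ev_1 ev_tt ev_tinv ev_add ev_diff ev_uminus ev_mult ev_power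

end

section \<open>The bar involution and the values at \<open>t = 1\<close> and
  \<open>t = -1\<close>\<close>

interpretation bar: laurent_eval fls_const "\<lambda>n. fls_X_intpow (- n)"
  rewrites "laurent_eval.ev fls_const (\<lambda>n. fls_X_intpow (- n)) = lbar"
proof -
  show *: "laurent_eval fls_const (\<lambda>n. fls_X_intpow (- n) :: K)"
  proof unfold_locales
    show "fls_X_intpow (- (m + n)) = fls_X_intpow (- m) * (fls_X_intpow (- n) :: K)" for m n
      unfolding fls_X_intpow_times_fls_X_intpow by simp
  qed (simp_all add: fls_plus_const)
  show "laurent_eval.ev fls_const (\<lambda>n. fls_X_intpow (- n)) = lbar"
    by (rule ext) (simp only: laurent_eval.ev_def[OF *] lbar_def)
qed

interpretation ev1: laurent_eval "\<lambda>x. x" "\<lambda>n. 1"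
  rewrites "laurent_eval.ev (\<lambda>x. x) (\<lambda>n. 1) = ev1"
proof -
  show *: "laurent_eval (\<lambda>x::rat. x) (\<lambda>n. 1)"
    by unfold_locales simp_all
  show "laurent_eval.ev (\<lambda>x. x) (\<lambda>n. 1) = ev1"
    by (simp add: laurent_eval.ev_def[OF *] ev1_def fun_eq_iff)
qed

text \<open>The value at \<open>t = -1\<close>. On integral coefficients \<open>floor\<close> merely
  changes the type from \<open>rat\<close> to \<open>int\<close>.\<close>

definition evm :: "K \<Rightarrow> int" where
  "evm f = (\<Sum>n | fls_nth f n \<noteq> 0. \<lfloor>fls_nth f n\<rfloor> * (if even n then 1 else -1))"

interpretation evm: laurent_eval floor "\<lambda>n. if even n then 1 else -1"
  rewrites "laurent_eval.ev floor (\<lambda>n. if even n then 1 else -1) = evm"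
proof -
  show *: "laurent_eval (floor :: rat \<Rightarrow> int) (\<lambda>n. if even n then 1 else -1)"
    by unfold_locales (auto simp: Ints_def simp flip: of_int_add of_int_mult)
  show "laurent_eval.ev floor (\<lambda>n. if even n then 1 else -1) = evm"
    by (simp add: laurent_eval.ev_def[OF *] evm_def fun_eq_iff)
qed

lemma lbar_LP: "f \<in> LP \<Longrightarrow> lbar f \<in> LP"
proof (induction rule: LP_induct)
  case (monom c n g)
  then show ?case
    by (simp only: bar.ev_add LP_lmonom bar.ev_lmonom LP_add)
qed (simp add: bar.ev_0 LP_0)

text \<open>The point \<open>t = -1\<close> is fixed by inversion: \<open>n\<close> and
  \<open>-n\<close> have the same parity.\<close>

lemma evm_lbar: "f \<in> LP \<Longrightarrow> evm (lbar f) = evm f"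
proof (induction rule: LP_induct)
  case (monom c n g)
  then show ?case
    by (simp only: bar.ev_add LP_lmonom bar.ev_lmonom evm.ev_add lbar_LP evm.ev_lmonom even_minus)
qed (simp add: bar.ev_0)

section \<open>Congruences modulo \<open>1 + t\<close>\<close>

lemma tinv_tt: "tinv * tt = 1" and tt_tinv: "tt * tinv = 1"
  using lmonom_mult[of 1 "-1" 1 1] lmonom_mult[of 1 1 1 "-1"]
  unfolding tt_eq_lmonom tinv_eq_lmonom by simp_all

text \<open>Modulo \<open>1 + t\<close> the unit \<open>t\<close> is \<open>-1\<close>, which is its
  own inverse, so raising or lowering the exponent by one flips the sign.\<close>

lemma intpow_cong_neg_one:
  "\<exists>q\<in>LP. fls_X_intpow n = of_int (if even n then 1 else -1) + (1 + tt) * q"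
proof (induction n rule: int_induct[of _ 0])
  case base
  show ?case by (rule bexI[of _ 0]) (simp_all add: LP_0)
next
  case (step1 i)
  then obtain q where q: "q \<in> LP"
    "(fls_X_intpow i :: K) = of_int (if even i then 1 else -1) + (1 + tt) * q" by blast
  let ?e = "of_int (if even i then 1 else -1) :: K"
  have "fls_X_intpow (i + 1) = fls_X_intpow i * tt"
    by (simp add: fls_X_conv_shift_1 fls_X_intpow_times_fls_X_intpow)
  also have "\<dots> = - ?e + (1 + tt) * (q * tt + ?e)"
    unfolding q(2) by (simp add: algebra_simps)
  finally show ?case
    using q(1) by (intro bexI[of _ "q * tt + ?e"]) (auto intro!: LP_intros)
next
  case (step2 i)
  then obtain q where q: "q \<in> LP"
    "(fls_X_intpow i :: K) = of_int (if even i then 1 else -1) + (1 + tt) * q" by blast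
  let ?e = "of_int (if even i then 1 else -1) :: K"
  have "fls_X_intpow (i - 1) = fls_X_intpow i * tinv"
    using fls_X_intpow_times_fls_X_intpow[of i "-1", where 'a = rat] by (simp add: fls_X_inv_conv_shift_1)
  also have "\<dots> = - ?e + (1 + tt) * (q * tinv + ?e * tinv)"
    unfolding q(2) using tt_tinv by algebra
  finally show ?case
    using q(1) by (intro bexI[of _ "q * tinv + ?e * tinv"]) (auto intro!: LP_intros)
qed

lemma LP_cong_evm:
  assumes "f \<in> LP"
  shows "\<exists>q\<in>LP. f = of_int (evm f) + (1 + tt) * q"
  using assms
proof (induction rule: LP_induct)
  case zero
  show ?case by (rule bexI[of _ 0]) (simp_all add: LP_0 evm.ev_0)
next
  case (monom c n g)
  obtain k where k: "c = of_int k" using monom(1) by (auto simp: Ints_def)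
  obtain q where q: "q \<in> LP" "g = of_int (evm g) + (1 + tt) * q" using monom by blast
  obtain r where r: "r \<in> LP" "fls_X_intpow n = of_int (if even n then 1 else -1) + (1 + tt) * r"
    using intpow_cong_neg_one by blast
  have k': "fls_const (of_int k :: rat) = of_int k" by (simp add: fls_of_int)
  have "lmonom c n + g = of_int (k * (if even n then 1 else -1) + evm g) + (1 + tt) * (of_int k * r + q)"
    unfolding k k' by (subst q(2), subst r(2)) (simp add: algebra_simps)
  moreover have "evm (lmonom c n + g) = k * (if even n then 1 else -1) + evm g"
    using monom by (simp only: evm.ev_add LP_lmonom evm.ev_lmonom k floor_of_int)
  moreover have "of_int k \<in> LP"
    using LP_lmonom[of "of_int k" 0] by (simp add: k' )
  ultimately show ?case
    using q(1) r(1) by (intro bexI[of _ "of_int k * r + q"]) (auto intro!: LP_intros)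
qed

text \<open>The quotient is again an integral Laurent polynomial and not just an element of the
  field; this later removes the denominators from \<open>phi\<close>.\<close>

lemma one_plus_tt_dvd:
  assumes "f \<in> LP" "evm f = 0"
  shows "\<exists>q\<in>LP. f = (1 + tt) * q"
  using LP_cong_evm[OF assms(1)] assms(2) by simp

section \<open>Semidirect products from complements\<close>

lemma semidirect_product_group:
  assumes "semidirect_action N H \<theta>"
  shows "group (semidirect_product N H \<theta>)"
proof -
  interpret N: group N using assms by (simp add: semidirect_action_def)
  interpret H: group H using assms by (simp add: semidirect_action_def)
  have iso: "\<And>h. h \<in> carrier H \<Longrightarrow> \<theta> h \<in> iso N N"
    and act: "\<And>h k n. h \<in> carrier H \<Longrightarrow> k \<in> carrier H \<Longrightarrow> n \<in> carrier N \<Longrightarrow>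
      \<theta> (h \<otimes>\<^bsub>H\<^esub> k) n = \<theta> h (\<theta> k n)"
    using assms by (simp_all add: semidirect_action_def)
  have cl: "\<theta> h n \<in> carrier N" if "h \<in> carrier H" "n \<in> carrier N" for h n
    using iso[OF that(1)] that(2) by (auto simp: iso_def hom_def)
  have mult: "\<theta> h (n \<otimes>\<^bsub>N\<^esub> m) = \<theta> h n \<otimes>\<^bsub>N\<^esub> \<theta> h m"
    if "h \<in> carrier H" "n \<in> carrier N" "m \<in> carrier N" for h n m
    using iso[OF that(1)] that(2,3) by (auto simp: iso_def hom_def)
  \<comment> \<open>The action law makes the map of the unit idempotent; being injective, it is the
    identity.\<close>
  have one: "\<theta> \<one>\<^bsub>H\<^esub> n = n" if "n \<in> carrier N" for n
  proof -
    have "\<theta> \<one>\<^bsub>H\<^esub> (\<theta> \<one>\<^bsub>H\<^esub> n) = \<theta> \<one>\<^bsub>H\<^esub> n" using act[of "\<one>\<^bsub>H\<^esub>" "\<one>\<^bsub>H\<^esub>" n] that by simp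
    then show ?thesis
      using iso[OF H.one_closed] cl[OF H.one_closed that] that
      by (auto simp: iso_def bij_betw_def dest: inj_onD)
  qed
  have one': "\<theta> h \<one>\<^bsub>N\<^esub> = \<one>\<^bsub>N\<^esub>" if "h \<in> carrier H" for h
    using iso[OF that] hom_one[of "\<theta> h" N N] N.is_group by (auto simp: iso_def)
  show ?thesis
  proof (rule groupI)
    fix x assume "x \<in> carrier (semidirect_product N H \<theta>)"
    then obtain n h where x: "x = (n, h)" "n \<in> carrier N" "h \<in> carrier H"
      by (auto simp: semidirect_product_def)
    let ?i = "inv\<^bsub>H\<^esub> h"
    have "\<theta> ?i (inv\<^bsub>N\<^esub> n) \<otimes>\<^bsub>N\<^esub> \<theta> ?i n = \<one>\<^bsub>N\<^esub>"
      using x by (simp add: one' flip: mult)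
    then show "\<exists>y\<in>carrier (semidirect_product N H \<theta>).
        y \<otimes>\<^bsub>semidirect_product N H \<theta>\<^esub> x = \<one>\<^bsub>semidirect_product N H \<theta>\<^esub>"
      using x by (intro bexI[of _ "(\<theta> ?i (inv\<^bsub>N\<^esub> n), ?i)"]) (auto simp: semidirect_product_def cl)
  qed (auto simp: semidirect_product_def cl mult act one N.m_assoc H.m_assoc)
qed

text \<open>The complement \<open>D\<close> of \<open>ker p\<close> modulo \<open>ker f\<close> need not inject into \<open>Q\<close>; it only has to do so
  after applying \<open>f\<close>.\<close>
lemma semidirect_of_section:
  assumes G: "group G" and X: "group X" and Q: "group Q"
    and f: "f \<in> hom G X" and p: "p \<in> hom G Q"
    and D: "subgroup D G" and surj: "p ` D = carrier Q"
    and triv: "\<And>d. d \<in> D \<Longrightarrow> p d = \<one>\<^bsub>Q\<^esub> \<Longrightarrow> f d = \<one>\<^bsub>X\<^esub>"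
    and ker: "kernel G X f \<subseteq> kernel G Q p"
  shows "subgroup (f ` kernel G Q p) X"
    and "\<exists>\<theta>. semidirect_action (X\<lparr>carrier := f ` kernel G Q p\<rparr>) Q \<theta> \<and>
      G Mod kernel G X f \<cong> semidirect_product (X\<lparr>carrier := f ` kernel G Q p\<rparr>) Q \<theta>"
proof -
  interpret G: group G by fact
  interpret X: group X by fact
  interpret Q: group Q by fact
  interpret f: group_hom G X f using f by unfold_locales
  interpret p: group_hom G Q p using p by unfold_locales
  interpret D: subgroup D G by fact
  let ?K = "kernel G Q p" and ?F = "f ` kernel G Q p"
  let ?N = "X\<lparr>carrier := ?F\<rparr>"
  show F: "subgroup ?F X"
    using f.subgroup_img_is_subgroup p.subgroup_kernel by blast
  interpret F: subgroup ?F X by fact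
  interpret N: group ?N by (rule X.subgroup_imp_group[OF F])
  \<comment> \<open>\<open>s\<close> only chooses preimages in \<open>D\<close>. Its composite with
    \<open>f\<close> is multiplicative, because elements of \<open>D\<close> with equal image under
    \<open>p\<close> have equal image under \<open>f\<close>.\<close>
  define s where "s q = (SOME d. d \<in> D \<and> p d = q)" for q
  have s: "s q \<in> D" "p (s q) = q" if "q \<in> carrier Q" for q
  proof -
    have "q \<in> p ` D" unfolding surj by (rule that)
    then have "\<exists>d. d \<in> D \<and> p d = q" by (elim imageE) auto
    from someI_ex[OF this] show "s q \<in> D" "p (s q) = q" unfolding s_def by auto
  qed
  have sG: "s q \<in> carrier G" if "q \<in> carrier Q" for q using s[OF that] by simp
  have fD: "f d = f e" if "d \<in> D" "e \<in> D" "p d = p e" for d e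
  proof -
    have "f (d \<otimes>\<^bsub>G\<^esub> inv\<^bsub>G\<^esub> e) = \<one>\<^bsub>X\<^esub>" using that by (intro triv) auto
    then show ?thesis using that by (simp add: X.inv_equality X.inv_solve_right')
  qed
  define \<sigma> where "\<sigma> q = f (s q)" for q
  have \<sigma>X: "\<sigma> q \<in> carrier X" if "q \<in> carrier Q" for q using sG[OF that] by (simp add: \<sigma>_def)
  have \<sigma>m: "\<sigma> (q \<otimes>\<^bsub>Q\<^esub> r) = \<sigma> q \<otimes>\<^bsub>X\<^esub> \<sigma> r" if "q \<in> carrier Q" "r \<in> carrier Q" for q r
  proof -
    have "f (s (q \<otimes>\<^bsub>Q\<^esub> r)) = f (s q \<otimes>\<^bsub>G\<^esub> s r)"
      using that s by (intro fD) (auto simp: sG)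
    then show ?thesis using that by (simp add: \<sigma>_def sG)
  qed
  have conj: "\<sigma> q \<otimes>\<^bsub>X\<^esub> n \<otimes>\<^bsub>X\<^esub> inv\<^bsub>X\<^esub> \<sigma> q \<in> ?F" if q: "q \<in> carrier Q" and n: "n \<in> ?F" for q n
  proof -
    obtain k where k: "n = f k" "k \<in> ?K" using n by blast
    then have kG: "k \<in> carrier G" "p k = \<one>\<^bsub>Q\<^esub>" by (auto simp: kernel_def)
    have "s q \<otimes>\<^bsub>G\<^esub> k \<otimes>\<^bsub>G\<^esub> inv\<^bsub>G\<^esub> s q \<in> ?K"
      using kG q by (simp add: kernel_def sG s)
    moreover have "\<sigma> q \<otimes>\<^bsub>X\<^esub> n \<otimes>\<^bsub>X\<^esub> inv\<^bsub>X\<^esub> \<sigma> q = f (s q \<otimes>\<^bsub>G\<^esub> k \<otimes>\<^bsub>G\<^esub> inv\<^bsub>G\<^esub> s q)"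
      using kG q k by (simp add: sG \<sigma>_def)
    ultimately show ?thesis by blast
  qed
  define \<theta> where "\<theta> q n = \<sigma> q \<otimes>\<^bsub>X\<^esub> n \<otimes>\<^bsub>X\<^esub> inv\<^bsub>X\<^esub> \<sigma> q" for q n
  have FX: "n \<in> carrier X" if "n \<in> ?F" for n using F.mem_carrier[OF that] .
  have \<theta>F: "\<theta> q n \<in> ?F" if "q \<in> carrier Q" "n \<in> ?F" for q n
    using conj[OF that] by (simp add: \<theta>_def)
  have act: "\<theta> (q \<otimes>\<^bsub>Q\<^esub> r) n = \<theta> q (\<theta> r n)" if "q \<in> carrier Q" "r \<in> carrier Q" "n \<in> carrier X" for q r n
    using that by (simp add: \<theta>_def \<sigma>m \<sigma>X X.inv_mult_group X.m_assoc)
  have \<sigma>1: "\<sigma> \<one>\<^bsub>Q\<^esub> = \<one>\<^bsub>X\<^esub>" using s[of "\<one>\<^bsub>Q\<^esub>"] by (simp add: \<sigma>_def triv)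
  have one: "\<theta> \<one>\<^bsub>Q\<^esub> n = n" if "n \<in> carrier X" for n
    using that by (simp add: \<theta>_def \<sigma>1)
  have mult: "\<theta> q (n \<otimes>\<^bsub>X\<^esub> m) = \<theta> q n \<otimes>\<^bsub>X\<^esub> \<theta> q m"
    if "q \<in> carrier Q" "n \<in> carrier X" "m \<in> carrier X" for q n m
  proof -
    have "inv\<^bsub>X\<^esub> \<sigma> q \<otimes>\<^bsub>X\<^esub> (\<sigma> q \<otimes>\<^bsub>X\<^esub> (m \<otimes>\<^bsub>X\<^esub> inv\<^bsub>X\<^esub> \<sigma> q)) = m \<otimes>\<^bsub>X\<^esub> inv\<^bsub>X\<^esub> \<sigma> q"
      using that \<sigma>X[OF that(1)] by (simp flip: X.m_assoc)
    then show ?thesis using that by (simp add: \<theta>_def \<sigma>X X.m_assoc)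
  qed
  have "\<theta> q \<in> iso ?N ?N" if q: "q \<in> carrier Q" for q
  proof -
    have "bij_betw (\<theta> q) ?F ?F"
      by (rule bij_betw_byWitness[of _ "\<theta> (inv\<^bsub>Q\<^esub> q)"])
        (use q in \<open>auto simp: one FX intro!: \<theta>F simp flip: act\<close>)
    then show ?thesis
      using q by (auto simp: iso_def hom_def \<theta>F FX mult)
  qed
  then have sa: "semidirect_action ?N Q \<theta>"
    unfolding semidirect_action_def
    using act FX N.is_group Q by auto
  let ?S = "semidirect_product ?N Q \<theta>"
  interpret S: group ?S by (rule semidirect_product_group[OF sa])
  \<comment> \<open>Dividing \<open>f g\<close> by the section value at \<open>p g\<close> leaves
    the component in the normal factor.\<close>
  define \<psi> where "\<psi> g = (f g \<otimes>\<^bsub>X\<^esub> inv\<^bsub>X\<^esub> \<sigma> (p g), p g)" for g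
  have \<psi>F: "f g \<otimes>\<^bsub>X\<^esub> inv\<^bsub>X\<^esub> \<sigma> (p g) \<in> ?F" if g: "g \<in> carrier G" for g
  proof -
    have pg: "p g \<in> carrier Q" using g by simp
    have "g \<otimes>\<^bsub>G\<^esub> inv\<^bsub>G\<^esub> s (p g) \<in> ?K" using g sG[OF pg] s(2)[OF pg] by (simp add: kernel_def)
    moreover have "f g \<otimes>\<^bsub>X\<^esub> inv\<^bsub>X\<^esub> \<sigma> (p g) = f (g \<otimes>\<^bsub>G\<^esub> inv\<^bsub>G\<^esub> s (p g))"
      using g sG[OF pg] by (simp add: \<sigma>_def)
    ultimately show ?thesis by blast
  qed
  have hom: "\<psi> \<in> hom G ?S"
  proof (rule homI)
    fix g assume "g \<in> carrier G"
    then show "\<psi> g \<in> carrier ?S" by (simp add: \<psi>_def semidirect_product_def \<psi>F)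
  next
    fix g k assume g: "g \<in> carrier G" and k: "k \<in> carrier G"
    have c: "\<sigma> (p g) \<in> carrier X" "\<sigma> (p k) \<in> carrier X" using g k by (auto intro: \<sigma>X)
    have "inv\<^bsub>X\<^esub> \<sigma> (p g) \<otimes>\<^bsub>X\<^esub> (\<sigma> (p g) \<otimes>\<^bsub>X\<^esub> x) = x" if "x \<in> carrier X" for x
      using that c by (simp flip: X.m_assoc)
    then show "\<psi> (g \<otimes>\<^bsub>G\<^esub> k) = \<psi> g \<otimes>\<^bsub>?S\<^esub> \<psi> k"
      using g k c
      by (simp add: \<psi>_def semidirect_product_def \<theta>_def \<sigma>m X.inv_mult_group X.m_assoc)
  qed
  interpret \<psi>: group_hom G ?S \<psi> using hom by unfold_locales
  have "kernel G ?S \<psi> = kernel G X f"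
  proof (intro equalityI subsetI)
    fix g assume "g \<in> kernel G ?S \<psi>"
    then show "g \<in> kernel G X f"
      by (auto simp: kernel_def \<psi>_def semidirect_product_def \<sigma>1)
  next
    \<comment> \<open>The kernel of \<open>f\<close> lies in that of \<open>p\<close>, so the second
      component dies along with the first.\<close>
    fix g assume "g \<in> kernel G X f"
    moreover from this have "g \<in> kernel G Q p" using ker by blast
    ultimately show "g \<in> kernel G ?S \<psi>"
      by (auto simp: kernel_def \<psi>_def semidirect_product_def \<sigma>1)
  qed
  moreover have "\<psi> ` carrier G = carrier ?S"
  proof (intro equalityI subsetI)
    fix x assume "x \<in> carrier ?S"
    then obtain k q where x: "x = (f k, q)" "k \<in> ?K" "q \<in> carrier Q"
      by (auto simp: semidirect_product_def)
    then have k: "k \<in> carrier G" "p k = \<one>\<^bsub>Q\<^esub>" by (auto simp: kernel_def)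
    have "\<psi> (k \<otimes>\<^bsub>G\<^esub> s q) = x"
      using x k sG[OF x(3)] s(2)[OF x(3)] by (simp add: \<psi>_def X.m_assoc \<sigma>_def)
    then show "x \<in> \<psi> ` carrier G" using k sG[OF x(3)] by blast
  qed (use \<psi>.hom_closed in blast)
  ultimately have "G Mod kernel G X f \<cong> ?S"
    using \<psi>.FactGroup_iso by simp
  then show "\<exists>\<theta>. semidirect_action ?N Q \<theta> \<and> G Mod kernel G X f \<cong> semidirect_product ?N Q \<theta>"
    using sa by blast
qed

section \<open>Words in two generators of finite order modulo the center\<close>

text \<open>A nonempty word begins with \<open>a\<close> and ends with a power of \<open>c\<close>;
  an initial power of \<open>c\<close> and a final \<open>a\<close> are kept apart in the normal
  form.\<close>

inductive_set ac_words :: "('a, 'b) monoid_scheme \<Rightarrow> 'a \<Rightarrow> 'a \<Rightarrow> 'a set" for G a c where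
  one: "\<one>\<^bsub>G\<^esub> \<in> ac_words G a c"
| ac: "p \<in> ac_words G a c \<Longrightarrow> p \<otimes>\<^bsub>G\<^esub> (a \<otimes>\<^bsub>G\<^esub> c) \<in> ac_words G a c"
| acc: "p \<in> ac_words G a c \<Longrightarrow> p \<otimes>\<^bsub>G\<^esub> (a \<otimes>\<^bsub>G\<^esub> (c \<otimes>\<^bsub>G\<^esub> c)) \<in> ac_words G a c"

lemma (in group) ac_words_closed:
  assumes "a \<in> carrier G" "c \<in> carrier G" "p \<in> ac_words G a c"
  shows "p \<in> carrier G"
  using assms(3) by induction (use assms(1,2) in auto)

text \<open>The normal form of the free product of cyclic groups of orders 2 and 3.\<close>
lemma (in group) generate_normal_form:
  assumes a: "a \<in> carrier G" and c: "c \<in> carrier G"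
    and Z: "subgroup Z G"
    and central: "\<And>z g. z \<in> Z \<Longrightarrow> g \<in> carrier G \<Longrightarrow> z \<otimes> g = g \<otimes> z"
    and a2: "a \<otimes> a \<in> Z" and c3: "c \<otimes> (c \<otimes> c) \<in> Z"
    and g: "g \<in> generate G {a, c}"
  shows "\<exists>l\<in>{\<one>, c, c \<otimes> c}. \<exists>p\<in>ac_words G a c. \<exists>r\<in>{\<one>, a}. \<exists>z\<in>Z. g = l \<otimes> p \<otimes> r \<otimes> z"
proof -
  interpret Z: subgroup Z G by fact
  \<comment> \<open>\<open>W\<close> is the set of normal forms. It contains the unit, so stability
    under right multiplication by the generators and their inverses puts the whole generated
    subgroup inside it.\<close>
  define W where "W = {l \<otimes> p \<otimes> r \<otimes> z | l p r z.
    l \<in> {\<one>, c, c \<otimes> c} \<and> p \<in> ac_words G a c \<and> r \<in> {\<one>, a} \<and> z \<in> Z}"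
  have WI: "l \<otimes> p \<otimes> r \<otimes> z \<in> W"
    if "l \<in> {\<one>, c, c \<otimes> c}" "p \<in> ac_words G a c" "r \<in> {\<one>, a}" "z \<in> Z" for l p r z
    using that unfolding W_def by blast
  note cl = ac_words_closed[OF a c]
  have zmove: "x \<otimes> z \<otimes> g = x \<otimes> g \<otimes> z" if "x \<in> carrier G" "z \<in> Z" "g \<in> carrier G" for x z g
    using that central[of z g] by (simp add: m_assoc)
  have WG: "W \<subseteq> carrier G" unfolding W_def using a c cl by auto
  have Wz: "w \<otimes> z \<in> W" if w: "w \<in> W" and z: "z \<in> Z" for w z
  proof -
    obtain l p r y where w: "w = l \<otimes> p \<otimes> r \<otimes> y" and
      h: "l \<in> {\<one>, c, c \<otimes> c}" "p \<in> ac_words G a c" "r \<in> {\<one>, a}" "y \<in> Z"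
      using w unfolding W_def by blast
    have "l \<in> carrier G" "p \<in> carrier G" "r \<in> carrier G" using h a c cl by auto
    then have "w \<otimes> z = l \<otimes> p \<otimes> r \<otimes> (y \<otimes> z)" using h z by (simp add: w m_assoc)
    then show ?thesis using WI[of l p r "y \<otimes> z"] h z by simp
  qed
  have Wa: "w \<otimes> a \<in> W" if w: "w \<in> W" for w
  proof -
    obtain l p r y where w: "w = l \<otimes> p \<otimes> r \<otimes> y" and
      h: "l \<in> {\<one>, c, c \<otimes> c}" "p \<in> ac_words G a c" "r \<in> {\<one>, a}" "y \<in> Z"
      using w unfolding W_def by blast
    have C: "l \<in> carrier G" "p \<in> carrier G" "r \<in> carrier G" using h a c cl by auto
    have eq: "w \<otimes> a = l \<otimes> p \<otimes> r \<otimes> a \<otimes> y" unfolding w using C h a by (intro zmove) auto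
    from h(3) consider "r = \<one>" | "r = a" by blast
    then show ?thesis
    proof cases
      case 1
      then have "w \<otimes> a = l \<otimes> p \<otimes> a \<otimes> y" using eq C by simp
      then show ?thesis using WI[of l p a y] h by simp
    next
      case 2
      then have "w \<otimes> a = l \<otimes> p \<otimes> \<one> \<otimes> ((a \<otimes> a) \<otimes> y)" using eq C a h by (simp add: m_assoc)
      then show ?thesis using WI[of l p \<one> "(a \<otimes> a) \<otimes> y"] h a2 by simp
    qed
  qed
  \<comment> \<open>A new \<open>c\<close> changes the last syllable: \<open>ac\<close> becomes
    \<open>acc\<close>, while \<open>acc\<close> becomes \<open>a\<close> times a central cube, and
    this \<open>a\<close> moves to the trailing position.\<close>
  have Wlc: "l \<otimes> p \<otimes> \<one> \<otimes> c \<in> W" if l: "l \<in> {\<one>, c, c \<otimes> c}" and p: "p \<in> ac_words G a c" for l p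
  proof -
    have lC: "l \<in> carrier G" using l c by auto
    show ?thesis
      using p
    proof cases
      case one
      consider "l = \<one>" | "l = c" | "l = c \<otimes> c" using l by blast
      then show ?thesis
      proof cases
        case 1
        then show ?thesis using WI[of c \<one> \<one> \<one>] ac_words.one[of G a c] c one by simp
      next
        case 2
        then show ?thesis using WI[of "c \<otimes> c" \<one> \<one> \<one>] ac_words.one[of G a c] c one by simp
      next
        case 3
        then show ?thesis
          using WI[of \<one> \<one> \<one> "c \<otimes> (c \<otimes> c)"] ac_words.one[of G a c] c one c3 by (simp add: m_assoc)
      qed
    next
      case (ac q)
      then have "q \<in> carrier G" using cl by blast
      then have "l \<otimes> p \<otimes> \<one> \<otimes> c = l \<otimes> (q \<otimes> (a \<otimes> (c \<otimes> c))) \<otimes> \<one> \<otimes> \<one>"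
        using ac lC a c by (simp add: m_assoc)
      then show ?thesis using WI[of l _ \<one> \<one>] l ac_words.acc[OF ac(2)] by simp
    next
      case (acc q)
      then have "q \<in> carrier G" using cl by blast
      then have "l \<otimes> p \<otimes> \<one> \<otimes> c = l \<otimes> q \<otimes> a \<otimes> (c \<otimes> (c \<otimes> c))"
        using acc lC a c by (simp add: m_assoc)
      then show ?thesis using WI[of l q a] l acc c3 by simp
    qed
  qed
  have Wc: "w \<otimes> c \<in> W" if w: "w \<in> W" for w
  proof -
    obtain l p r y where w: "w = l \<otimes> p \<otimes> r \<otimes> y" and
      h: "l \<in> {\<one>, c, c \<otimes> c}" "p \<in> ac_words G a c" "r \<in> {\<one>, a}" "y \<in> Z"
      using w unfolding W_def by blast
    have C: "l \<in> carrier G" "p \<in> carrier G" "r \<in> carrier G" using h a c cl by auto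
    have eq: "w \<otimes> c = l \<otimes> p \<otimes> r \<otimes> c \<otimes> y" unfolding w using C h c by (intro zmove) auto
    from h(3) consider "r = \<one>" | "r = a" by blast
    then show ?thesis
    proof cases
      case 1
      then show ?thesis using eq Wlc[OF h(1,2)] Wz[OF _ h(4)] by simp
    next
      case 2
      have "w \<otimes> c = l \<otimes> (p \<otimes> (a \<otimes> c)) \<otimes> \<one> \<otimes> y" using eq C a c h 2 by (simp add: m_assoc)
      then show ?thesis using WI[of l _ \<one> y] h ac_words.ac[OF h(2)] by simp
    qed
  qed
  \<comment> \<open>Modulo \<open>Z\<close> the inverses of \<open>a\<close> and \<open>c\<close>
    are positive powers, so the closure facts already shown cover them.\<close>
  have inv_a: "inv a = a \<otimes> inv (a \<otimes> a)"
    using a by (simp add: inv_mult_group flip: m_assoc)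
  have inv_c: "inv c = c \<otimes> c \<otimes> inv (c \<otimes> (c \<otimes> c))"
    using c by (simp add: inv_mult_group flip: m_assoc) (simp add: m_assoc)
  have "g \<in> carrier G \<and> (\<forall>w\<in>W. w \<otimes> g \<in> W)"
    using g
  proof (induction rule: generate.induct)
    case one
    then show ?case using WG by auto
  next
    case (incl h)
    then show ?case using Wa Wc a c by auto
  next
    case (inv h)
    have "w \<otimes> inv a \<in> W" if "w \<in> W" for w
    proof -
      have "w \<otimes> inv a = w \<otimes> a \<otimes> inv (a \<otimes> a)"
        using that WG a by (subst inv_a) (auto simp: m_assoc)
      then show ?thesis using Wz Wa that a2 by simp
    qed
    moreover have "w \<otimes> inv c \<in> W" if "w \<in> W" for w
    proof -
      have "w \<otimes> inv c = w \<otimes> c \<otimes> c \<otimes> inv (c \<otimes> (c \<otimes> c))"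
        using that WG c by (subst inv_c) (auto simp: m_assoc)
      then show ?thesis using Wz Wc that c3 by simp
    qed
    ultimately show ?case using inv a c by auto
  next
    case (eng h k)
    then show ?case using WG by (auto simp flip: m_assoc)
  qed
  moreover have "\<one> \<in> W" using WI[of \<one> \<one> \<one> \<one>] ac_words.one[of G a c] by simp
  ultimately have "g \<in> W" by (metis l_one)
  then show ?thesis unfolding W_def by blast
qed

no_notation fps_nth (infixl \<open>$\<close> 75)

section \<open>Matrices over Laurent polynomials\<close>

lemmas mat_simps = vec_eq_iff forall_2 forall_3 sum_2 sum_3 matrix_matrix_mult_def
  vector_matrix_mult_def matrix_vector_mult_def transpose_def mat_def

lemma (in laurent_eval) ev_matrix_mult:
  fixes A :: "K^'n^'m" and B :: "K^'l^'n"
  assumes "\<And>i j. A$i$j \<in> LP" "\<And>i j. B$i$j \<in> LP"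
  shows "(\<chi> i j. ev ((A ** B)$i$j)) = (\<chi> i j. ev (A$i$j)) ** (\<chi> i j. ev (B$i$j))"
  by (simp add: vec_eq_iff matrix_matrix_mult_def ev_sum ev_mult LP_mult assms)

lemma (in laurent_eval) ev_mat_1: "(\<chi> i j. ev ((mat 1 :: K^'n^'n)$i$j)) = mat 1"
  by (simp add: vec_eq_iff mat_def ev_0 ev_1)

lemma mbar_mult:
  "(\<And>i j. A$i$j \<in> LP) \<Longrightarrow> (\<And>i j. B$i$j \<in> LP) \<Longrightarrow> mbar (A ** B) = mbar A ** mbar B"
  unfolding mbar_def by (rule bar.ev_matrix_mult)

lemma mbar_mat_1: "mbar (mat 1) = mat 1"
  unfolding mbar_def by (rule bar.ev_mat_1)

lemma LP_matrix_mult: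
  "(\<And>i j. A$i$j \<in> LP) \<Longrightarrow> (\<And>i j. B$i$j \<in> LP) \<Longrightarrow> (A ** B)$i$j \<in> LP"
  by (simp add: matrix_matrix_mult_def LP_sum LP_mult)

lemma GL_LP_entry: "GL_LP A \<Longrightarrow> A$i$j \<in> LP"
  by (simp add: GL_LP_def)

lemma GL_LP_mult: assumes "GL_LP A" "GL_LP B" shows "GL_LP (A ** B)"
proof -
  obtain A' B' where A': "\<forall>i j. A'$i$j \<in> LP" "A ** A' = mat 1" "A' ** A = mat 1"
    and B': "\<forall>i j. B'$i$j \<in> LP" "B ** B' = mat 1" "B' ** B = mat 1"
    using assms unfolding GL_LP_def by metis
  have "A ** B ** (B' ** A') = mat 1" "B' ** A' ** (A ** B) = mat 1"
    by (metis A'(2) B'(2) matrix_mul_assoc matrix_mul_rid)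
      (metis A'(3) B'(3) matrix_mul_assoc matrix_mul_rid)
  then show ?thesis
    unfolding GL_LP_def using assms A'(1) B'(1)
    by (intro conjI allI exI[of _ "B' ** A'"] LP_matrix_mult) (auto simp: GL_LP_entry)
qed

section \<open>Permutation matrices\<close>

lemma permutation_matrix_mult_entries:
  "(\<chi> i j. if p i = j then 1 else 0) ** (\<chi> i j. if q i = j then 1 else 0)
    = ((\<chi> i j. if q (p i) = j then 1 else 0) :: rat^'n^'n)"
  by (simp add: vec_eq_iff matrix_matrix_mult_def if_distrib[of "\<lambda>x. x * y" for y] cong: if_cong)

lemma permutation_matrix_mult:
  assumes "permutation_matrix M" "permutation_matrix N"
  shows "permutation_matrix (M ** N)"
proof -
  obtain p q where "p permutes UNIV" "M = (\<chi> i j. if p i = j then 1 else 0)"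
    "q permutes UNIV" "N = (\<chi> i j. if q i = j then 1 else 0)"
    using assms unfolding permutation_matrix_def by blast
  then show ?thesis
    unfolding permutation_matrix_def
    by (intro exI[of _ "q \<circ> p"] conjI permutes_compose)
      (simp_all add: permutation_matrix_mult_entries)
qed

lemma permutation_matrix_mat_1: "permutation_matrix (mat 1)"
  unfolding permutation_matrix_def
  by (intro exI[of _ id] conjI permutes_id) (simp add: mat_def)

text \<open>The matrix of the inverse permutation is a right inverse of \<open>M\<close>, and a left
  inverse must coincide with it.\<close>

lemma permutation_matrix_inverse:
  fixes M N :: "rat^'n^'n"
  assumes "permutation_matrix M" "N ** M = mat 1"
  shows "permutation_matrix N"
proof -
  obtain p where p: "p permutes UNIV" "M = (\<chi> i j. if p i = j then 1 else 0)"
    using assms unfolding permutation_matrix_def by blast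
  let ?P = "(\<chi> i j. if inv_into UNIV p i = j then 1 else 0) :: rat^'n^'n"
  have "M ** ?P = mat 1"
    unfolding p(2) permutation_matrix_mult_entries
    by (simp add: permutes_inverses[OF p(1)] mat_def)
  then have "N = ?P"
    by (metis assms(2) matrix_mul_assoc matrix_mul_lid matrix_mul_rid)
  then show ?thesis
    unfolding permutation_matrix_def using permutes_inv[OF p(1)] by blast
qed

section \<open>The groups of Burau matrices\<close>

lemma Burau_GL_LP: "A \<in> Burau \<Longrightarrow> GL_LP A"
  by (simp add: Burau_def)

lemma Burau_fixes:
  assumes "A \<in> Burau"
  shows "vB v* A = vB" "A *v ones3 = ones3" "mbar A ** J3 ** transpose A = J3"
  using assms unfolding Burau_def by blast+

lemma BurauI:
  "GL_LP A \<Longrightarrow> vB v* A = vB \<Longrightarrow> A *v ones3 = ones3 \<Longrightarrow> mbar A ** J3 ** transpose A = J3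
    \<Longrightarrow> A \<in> Burau"
  unfolding Burau_def by blast

lemmas Burau_entry = GL_LP_entry[OF Burau_GL_LP]

lemma Burau_mult:
  assumes A: "A \<in> Burau" and B: "B \<in> Burau"
  shows "A ** B \<in> Burau"
proof -
  \<comment> \<open>\<open>mbar\<close> keeps the order of a product and transposition reverses it,
    so the form of \<open>B\<close> sits inside that of \<open>A\<close>.\<close>
  have form: "mbar (A ** B) ** J3 ** transpose (A ** B) = mbar A ** (mbar B ** J3 ** transpose B) ** transpose A"
    by (simp add: mbar_mult Burau_entry[OF A] Burau_entry[OF B] matrix_transpose_mul matrix_mul_assoc)
  show ?thesis
  proof (rule BurauI)
    show "GL_LP (A ** B)" using A B by (intro GL_LP_mult Burau_GL_LP)
    show "vB v* (A ** B) = vB"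
      by (simp only: vector_matrix_mul_assoc[symmetric] Burau_fixes[OF A] Burau_fixes[OF B])
    show "A ** B *v ones3 = ones3"
      by (simp only: matrix_vector_mul_assoc[symmetric] Burau_fixes[OF A] Burau_fixes[OF B])
    show "mbar (A ** B) ** J3 ** transpose (A ** B) = J3"
      by (simp only: form Burau_fixes[OF A] Burau_fixes[OF B])
  qed
qed

lemma GL_LP_mat_1: "GL_LP (mat 1 :: K^'n^'n)"
proof -
  have "(mat 1 :: K^'n^'n)$i$j \<in> LP" for i j by (simp add: mat_def LP_intros)
  then show ?thesis unfolding GL_LP_def by (auto intro!: exI[of _ "mat 1"])
qed

lemma Burau_mat_1: "mat 1 \<in> Burau"
  by (simp add: Burau_def GL_LP_mat_1 mbar_mat_1 transpose_mat)

lemma Burau_inverse: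
  assumes A: "A \<in> Burau"
  obtains B where "B \<in> Burau" "A ** B = mat 1" "B ** A = mat 1"
proof -
  obtain B where B: "\<forall>i j. B$i$j \<in> LP" "A ** B = mat 1" "B ** A = mat 1"
    using Burau_GL_LP[OF A] unfolding GL_LP_def by blast
  have "GL_LP B" unfolding GL_LP_def using B Burau_entry[OF A] by blast
  moreover have "vB v* B = vB"
    by (metis A B(2) Burau_fixes(1) vector_matrix_mul_assoc vector_matrix_mul_rid)
  moreover have "B *v ones3 = ones3"
    by (metis A B(3) Burau_fixes(2) matrix_vector_mul_assoc matrix_vector_mul_lid)
  moreover have "mbar B ** J3 ** transpose B = J3"
  proof -
    \<comment> \<open>Replacing \<open>J3\<close> by its expression through \<open>A\<close> places
      \<open>A\<close> next to its inverse on both sides.\<close>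
    have "mbar B ** J3 ** transpose B = mbar B ** (mbar A ** J3 ** transpose A) ** transpose B"
      by (simp only: Burau_fixes[OF A])
    also have "\<dots> = mbar (B ** A) ** J3 ** transpose (B ** A)"
      using B(1) by (simp add: mbar_mult Burau_entry[OF A] matrix_transpose_mul matrix_mul_assoc)
    also have "\<dots> = J3"
      by (simp add: B(3) mbar_mat_1 transpose_mat)
    finally show ?thesis .
  qed
  ultimately have "B \<in> Burau" by (rule BurauI)
  then show ?thesis using that B(2,3) by blast
qed

lemma Salter_Burau: "A \<in> Salter \<Longrightarrow> A \<in> Burau"
  by (simp add: Salter_def)

lemma Salter_mult: "A \<in> Salter \<Longrightarrow> B \<in> Salter \<Longrightarrow> A ** B \<in> Salter"
  by (simp add: Salter_def Burau_mult ev1.ev_matrix_mult Burau_entry permutation_matrix_mult)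

lemma Salter_mat_1: "mat 1 \<in> Salter"
  unfolding Salter_def using Burau_mat_1 permutation_matrix_mat_1 ev1.ev_mat_1[where 'n = 3] by simp

lemma Salter_inverse:
  assumes A: "A \<in> Salter"
  obtains B where "B \<in> Salter" "A ** B = mat 1" "B ** A = mat 1"
proof -
  obtain B where B: "B \<in> Burau" "A ** B = mat 1" "B ** A = mat 1"
    using Burau_inverse[OF Salter_Burau[OF A]] .
  have "(\<chi> i j. ev1 (B$i$j)) ** (\<chi> i j. ev1 (A$i$j)) = mat 1"
    using A B by (simp flip: ev1.ev_matrix_mult add: Burau_entry Salter_Burau ev1.ev_mat_1)
  then have "B \<in> Salter"
    using A B(1) permutation_matrix_inverse unfolding Salter_def by blast
  then show ?thesis using that B by blast
qed

lemma Salter_grp_simps [simp]: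
  "carrier Salter_grp = Salter" "x \<otimes>\<^bsub>Salter_grp\<^esub> y = x ** y" "\<one>\<^bsub>Salter_grp\<^esub> = mat 1"
  by (simp_all add: Salter_grp_def)

lemma group_Salter_grp: "group Salter_grp"
  by (rule groupI) (auto simp: Salter_mult Salter_mat_1 matrix_mul_assoc elim: Salter_inverse)

interpretation Salter: group Salter_grp
  by (rule group_Salter_grp)

lemma tt_neq_0: "tt \<noteq> 0"
  by simp

lemma one_plus_tt_neq_0: "1 + tt \<noteq> 0"
proof
  assume "1 + tt = 0"
  then have "ev1 (1 + tt) = 0" by (simp add: ev1.ev_0)
  then show False by (simp add: ev1.ev_simps LP_intros)
qed

lemma one_plus_tt_plus_tt2_neq_0: "1 + tt + tt^2 \<noteq> 0"
proof
  assume "1 + tt + tt^2 = 0"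
  then have "ev1 (1 + tt + tt^2) = 0" by (simp add: ev1.ev_0)
  then show False by (simp add: ev1.ev_simps LP_intros)
qed

lemma tinv_eq: "tinv = 1 / tt"
  using tt_tinv tt_neq_0 by (simp only: eq_divide_eq mult.commute simp_thms if_True not_False_eq_True)

lemma Burau_row_sum: "A \<in> Burau \<Longrightarrow> A$i$1 + A$i$2 + A$i$3 = 1"
  unfolding Burau_def ones3_def
  using exhaust_3[of i] by (auto simp: mat_simps)

lemma Burau_weighted_column_sum:
  assumes "A \<in> Burau"
  shows "tt * A$1$1 + tt^2 * A$2$1 + tt^3 * A$3$1 = tt"
    and "tt * A$1$2 + tt^2 * A$2$2 + tt^3 * A$3$2 = tt^2"
    and "tt * A$1$3 + tt^2 * A$2$3 + tt^3 * A$3$3 = tt^3"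
  using assms unfolding Burau_def vB_def by (simp_all add: mat_simps mult.commute)

section \<open>The reduced representation\<close>

text \<open>The columns of \<open>kerv_basis\<close> span the kernel of \<open>vB\<close>, and \<open>phi A\<close> is the matrix of \<open>A\<close> on this
  kernel.\<close>
definition kerv_basis :: "K^2^3" where
  "kerv_basis = vector [vector [tt + tt^2, 0], vector [-1, tt], vector [-1, -1]]"

lemma phi_entries:
  "phi A $ 1 $ 1 = (A$1$1 * (1 + tt + tt^2) - 1) / (tt * (1 + tt))"
  "phi A $ 1 $ 2 = (A$1$1 + A$1$2 * (1 + tt) - 1) / (tt * (1 + tt))"
  "phi A $ 2 $ 1 = tinv * phi A $ 1 $ 1 + (A$2$1 * (1 + tt + tt^2) - 1) / tt"
  "phi A $ 2 $ 2 = tinv * phi A $ 1 $ 2 + (A$2$1 + A$2$2 * (1 + tt) - 1) / tt"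
  using one_plus_tt_neq_0 by (simp_all add: phi_def Let_def)

text \<open>The \<open>f\<close> are the entries of a column in the kernel of \<open>vB\<close>, and
  \<open>g1\<close>, \<open>g2\<close> are its coordinates in \<open>kerv_basis\<close>; the kernel
  relation yields the third entry.\<close>

lemma reduced_column_identity:
  fixes t :: "'a::field"
  assumes "t \<noteq> 0" "1 + t \<noteq> 0"
    and g1: "g1 = f1 / (t * (1 + t))" and g2: "g2 = 1 / t * g1 + f2 / t"
    and v: "t * f1 + t^2 * f2 + t^3 * f3 = 0"
  shows "f1 = (t + t^2) * g1" "f2 = t * g2 - g1" "f3 = - g1 - g2"
proof -
  have "t + t^2 = t * (1 + t)" by (simp add: power2_eq_square distrib_left)
  then show f1: "f1 = (t + t^2) * g1" using assms(1,2) by (simp add: g1)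
  show f2: "f2 = t * g2 - g1" using assms(1) by (simp add: g2 field_simps)
  have "t^3 * (f3 - (- g1 - g2)) = 0"
    using v unfolding f1 f2 by (simp add: algebra_simps power2_eq_square power3_eq_cube)
  then show "f3 = - g1 - g2" using assms(1) by simp
qed

text \<open>The bracketed terms will be the entries of the two columns of
  \<open>A ** kerv_basis\<close>; the column relations from \<open>vB v* A = vB\<close> make
  \<open>vB\<close> annihilate both.\<close>

lemma weighted_sum_identities:
  fixes t :: "'a::comm_ring_1"
  assumes "t * x1 + t^2 * x2 + t^3 * x3 = t"
  shows "t * (x1 * (1 + t + t^2) - 1) + t^2 * (x2 * (1 + t + t^2) - 1) + t^3 * (x3 * (1 + t + t^2) - 1) = 0"
    and "t * y1 + t^2 * y2 + t^3 * y3 = t^2 \<Longrightarrow>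
      t * (x1 + y1 * (1 + t) - 1) + t^2 * (x2 + y2 * (1 + t) - 1) + t^3 * (x3 + y3 * (1 + t) - 1) = 0"
proof -
  have "t * (x1 * (1 + t + t^2) - 1) + t^2 * (x2 * (1 + t + t^2) - 1) + t^3 * (x3 * (1 + t + t^2) - 1)
    = (1 + t + t^2) * (t * x1 + t^2 * x2 + t^3 * x3) - (1 + t + t^2) * t"
    by (simp add: algebra_simps power2_eq_square power3_eq_cube)
  then show "t * (x1 * (1 + t + t^2) - 1) + t^2 * (x2 * (1 + t + t^2) - 1) + t^3 * (x3 * (1 + t + t^2) - 1) = 0"
    unfolding assms by simp
  assume y: "t * y1 + t^2 * y2 + t^3 * y3 = t^2"
  have "t * (x1 + y1 * (1 + t) - 1) + t^2 * (x2 + y2 * (1 + t) - 1) + t^3 * (x3 + y3 * (1 + t) - 1)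
    = (t * x1 + t^2 * x2 + t^3 * x3) + (1 + t) * (t * y1 + t^2 * y2 + t^3 * y3) - t - (1 + t) * t^2"
    by (simp add: algebra_simps power2_eq_square power3_eq_cube)
  then show "t * (x1 + y1 * (1 + t) - 1) + t^2 * (x2 + y2 * (1 + t) - 1) + t^3 * (x3 + y3 * (1 + t) - 1) = 0"
    unfolding assms y by simp
qed

lemma Burau_kerv_basis:
  assumes "A \<in> Burau"
  shows "A ** kerv_basis = kerv_basis ** phi A"
proof -
  note r = Burau_row_sum[OF assms] and c = Burau_weighted_column_sum[OF assms]
  \<comment> \<open>Row sum one eliminates \<open>A$i$3\<close> and produces exactly the numerators
    in \<open>phi\<close>.\<close>
  have e1: "(A ** kerv_basis)$i$1 = A$i$1 * (1 + tt + tt^2) - 1" for i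
    using r[of i] by (simp add: mat_simps kerv_basis_def algebra_simps)
  have e2: "(A ** kerv_basis)$i$2 = A$i$1 + A$i$2 * (1 + tt) - 1" for i
    using r[of i] by (simp add: mat_simps kerv_basis_def algebra_simps)
  note v1 = weighted_sum_identities(1)[OF c(1)] and v2 = weighted_sum_identities(2)[OF c(1,2)]
  note i1 = reduced_column_identity[OF tt_neq_0 one_plus_tt_neq_0 phi_entries(1) phi_entries(3)[unfolded tinv_eq] v1]
  note i2 = reduced_column_identity[OF tt_neq_0 one_plus_tt_neq_0 phi_entries(2) phi_entries(4)[unfolded tinv_eq] v2]
  have rhs: "(kerv_basis ** phi A)$1$j = (tt + tt^2) * phi A$1$j"
    "(kerv_basis ** phi A)$2$j = tt * phi A$2$j - phi A$1$j"
    "(kerv_basis ** phi A)$3$j = - phi A$1$j - phi A$2$j" for j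
    by (simp_all add: mat_simps kerv_basis_def)
  show ?thesis
    unfolding vec_eq_iff forall_2 forall_3 e1 e2 rhs using i1 i2 by blast
qed

text \<open>The first two rows of \<open>kerv_basis\<close> form a triangular block with nonzero
  diagonal entries \<open>t(1 + t)\<close> and \<open>t\<close>.\<close>

lemma kerv_basis_cancel:
  assumes "kerv_basis ** X = kerv_basis ** Y"
  shows "X = Y"
proof -
  have "tt * (1 + tt) * X$1$j = tt * (1 + tt) * Y$1$j" "tt * X$2$j - X$1$j = tt * Y$2$j - Y$1$j" for j
    using arg_cong[OF assms, of "\<lambda>M. M$1$j"] arg_cong[OF assms, of "\<lambda>M. M$2$j"]
    by (simp_all add: mat_simps kerv_basis_def power2_eq_square algebra_simps)
  moreover from this(1) have "X$1$j = Y$1$j" for j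
    using tt_neq_0 one_plus_tt_neq_0 by simp
  ultimately show ?thesis using tt_neq_0 by (simp add: vec_eq_iff forall_2)
qed

lemma phi_mult:
  assumes "A \<in> Burau" "B \<in> Burau"
  shows "phi (A ** B) = phi A ** phi B"
proof (rule kerv_basis_cancel)
  have "kerv_basis ** phi (A ** B) = A ** B ** kerv_basis"
    using assms by (simp add: Burau_kerv_basis Burau_mult)
  also have "\<dots> = A ** kerv_basis ** phi B"
    using assms(2) by (simp add: Burau_kerv_basis flip: matrix_mul_assoc)
  finally show "kerv_basis ** phi (A ** B) = kerv_basis ** (phi A ** phi B)"
    using assms(1) by (simp add: Burau_kerv_basis matrix_mul_assoc)
qed

lemma phi_mat_1: "phi (mat 1) = mat 1"
  by (rule kerv_basis_cancel) (simp flip: Burau_kerv_basis add: Burau_mat_1)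

lemma reduced_kernel_trivial:
  fixes t :: "'a::comm_ring_1"
  assumes "x1 + x2 + x3 = 0" "(t + t^2) * x1 - x2 - x3 = 0" "t * x2 - x3 = 0"
  shows "(1 + t + t^2) * x1 = 0" "x1 + (1 + t) * x2 = 0" "x3 = t * x2"
proof -
  have "(1 + t + t^2) * x1 = (x1 + x2 + x3) + ((t + t^2) * x1 - x2 - x3)"
    "x1 + (1 + t) * x2 = (x1 + x2 + x3) + (t * x2 - x3)"
    by (simp_all add: algebra_simps)
  then show "(1 + t + t^2) * x1 = 0" "x1 + (1 + t) * x2 = 0" unfolding assms by simp_all
  show "x3 = t * x2" using assms(3) by simp
qed

text \<open>Both matrices fix \<open>ones3\<close>, on which \<open>vB\<close> takes the nonzero
  value \<open>t(1 + t + t^2)\<close>. Hence \<open>ones3\<close> and the columns of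
  \<open>kerv_basis\<close> together span the whole space.\<close>

lemma phi_inj:
  assumes A: "A \<in> Burau" and B: "B \<in> Burau" and eq: "phi A = phi B"
  shows "A = B"
proof -
  have "A$i = B$i" for i
  proof -
    define x where "x j = A$i$j - B$i$j" for j
    have W: "A ** kerv_basis = B ** kerv_basis" using A B eq by (simp add: Burau_kerv_basis)
    have "x 1 + x 2 + x 3 = 0"
      using Burau_row_sum[OF A, of i] Burau_row_sum[OF B, of i] by (simp add: x_def algebra_simps)
    moreover have "(tt + tt^2) * x 1 - x 2 - x 3 = 0" "tt * x 2 - x 3 = 0"
      using arg_cong[OF W, of "\<lambda>M. M$i$1"] arg_cong[OF W, of "\<lambda>M. M$i$2"]
      by (simp_all add: mat_simps kerv_basis_def x_def algebra_simps)
    ultimately have x: "(1 + tt + tt^2) * x 1 = 0" "x 1 + (1 + tt) * x 2 = 0" "x 3 = tt * x 2"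
      by (rule reduced_kernel_trivial)+
    from x(1) have "x 1 = 0" using one_plus_tt_plus_tt2_neq_0 by simp
    then have "x 2 = 0" using x(2) one_plus_tt_neq_0 by simp
    then show "A$i = B$i" using x(3) \<open>x 1 = 0\<close> by (simp add: vec_eq_iff forall_3 x_def)
  qed
  then show ?thesis by (simp add: vec_eq_iff)
qed

section \<open>Specialisation at \<open>t = -1\<close>\<close>

text \<open>The integer matrix at \<open>t = -1\<close> of the right action of \<open>A\<close> on the row vectors with sum zero, in
  the basis \<open>(1,-1,0), (0,1,-1)\<close>.\<close>
definition spec :: "K^3^3 \<Rightarrow> int^2^2" where
  "spec A = vector [vector [evm (A$1$1 - A$2$1), evm (A$2$3 - A$1$3)],
                    vector [evm (A$2$1 - A$3$1), evm (A$3$3 - A$2$3)]]"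

lemma spec_entries:
  assumes "A \<in> Burau"
  shows "spec A $1$1 = evm (A$1$1) - evm (A$2$1)" "spec A $1$2 = evm (A$2$3) - evm (A$1$3)"
    "spec A $2$1 = evm (A$2$1) - evm (A$3$1)" "spec A $2$2 = evm (A$3$3) - evm (A$2$3)"
  using assms by (simp_all add: spec_def evm.ev_simps Burau_entry)

lemma evm_row_sum:
  assumes "A \<in> Burau"
  shows "evm (A$i$2) = 1 - evm (A$i$1) - evm (A$i$3)"
proof -
  have "evm (A$i$1 + A$i$2 + A$i$3) = 1" by (simp add: Burau_row_sum assms evm.ev_1)
  then show ?thesis using assms by (simp add: evm.ev_add LP_add Burau_entry)
qed

text \<open>Rows of \<open>A\<close> sum to one, so the sum-zero row vectors are invariant under
  right multiplication by \<open>A\<close>. Coordinates are read off along rows, which keeps the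
  order of the factors.\<close>

lemma spec_mult:
  assumes A: "A \<in> Burau" and B: "B \<in> Burau"
  shows "spec (A ** B) = spec A ** spec B"
proof -
  have e: "evm ((A ** B)$i$j) = evm (A$i$1) * evm (B$1$j) + evm (A$i$2) * evm (B$2$j) + evm (A$i$3) * evm (B$3$j)"
    for i j
    by (simp add: matrix_matrix_mult_def sum_3 evm.ev_simps LP_intros Burau_entry[OF A] Burau_entry[OF B])
  show ?thesis
    by (simp add: vec_eq_iff forall_2 spec_entries Burau_mult A B e evm_row_sum[OF A])
      (simp add: spec_entries A B matrix_matrix_mult_def sum_2 algebra_simps)
qed

lemma spec_mat_1: "spec (mat 1) = mat 1"
  by (simp add: vec_eq_iff forall_2 spec_entries Burau_mat_1) (simp add: mat_def evm.ev_simps)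

lemma inverse_pair_simps:
  fixes s t :: "'a::comm_ring_1"
  assumes "t * s = 1"
  shows "t * s = 1" "s * t = 1" "t * (s * x) = x" "s * (t * x) = x"
proof -
  show ts: "t * s = 1" by fact
  show st: "s * t = 1" using ts by (subst mult.commute)
  show "t * (s * x) = x" "s * (t * x) = x"
    by (simp_all only: mult.assoc[symmetric] ts st mult_1)
qed

text \<open>On row vectors with sum zero the Hermitian form is divisible by \<open>1 + t\<close>, and the quotient is
  symplectic at \<open>t = -1\<close>. Here \<open>b\<^sub>1, b\<^sub>2\<close> and \<open>a\<^sub>2, a\<^sub>3\<close> are rows of \<open>\<bar>A\<close> and \<open>A\<close>.\<close>
lemma form_on_differences:
  fixes t s :: "'a::idom"
  assumes st: "s * t = 1" and t: "1 + t \<noteq> 0"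
    and b: "b12 = 1 - b11 - b13" "b22 = 1 - b21 - b23"
    and a: "a22 = 1 - a21 - a23" "a32 = 1 - a31 - a33"
    and e12: "b11 * (a21 - s * a22 - s * a23) + b12 * (- t * a21 + a22 - s * a23)
      + b13 * (- t * a21 - t * a22 + a23) = - s"
    and e13: "b11 * (a31 - s * a32 - s * a33) + b12 * (- t * a31 + a32 - s * a33)
      + b13 * (- t * a31 - t * a32 + a33) = - s"
    and e22: "b21 * (a21 - s * a22 - s * a23) + b22 * (- t * a21 + a22 - s * a23)
      + b23 * (- t * a21 - t * a22 + a23) = 1"
    and e23: "b21 * (a31 - s * a32 - s * a33) + b22 * (- t * a31 + a32 - s * a33)
      + b23 * (- t * a31 - t * a32 + a33) = - s"
  shows "(b11 - b21) * (1 + s) * (a21 - a31) - s * (b11 - b21) * (a33 - a23)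
    - (b23 - b13) * (a21 - a31) + (b23 - b13) * (1 + s) * (a33 - a23) = - s"
proof -
  define x y z w where "x = b11 - b21" and "y = b23 - b13" and "z = a21 - a31" and "w = a33 - a23"
  have ts: "t * s = 1" using st by (subst mult.commute)
  \<comment> \<open>The alternating sum of the four equations pairs row 1 minus row 2 of the
    conjugate with row 2 minus row 3 of the matrix.\<close>
  have "(b11 * (a21 - s * a22 - s * a23) + b12 * (- t * a21 + a22 - s * a23)
      + b13 * (- t * a21 - t * a22 + a23))
    - (b11 * (a31 - s * a32 - s * a33) + b12 * (- t * a31 + a32 - s * a33)
      + b13 * (- t * a31 - t * a32 + a33))
    - (b21 * (a21 - s * a22 - s * a23) + b22 * (- t * a21 + a22 - s * a23)
      + b23 * (- t * a21 - t * a22 + a23))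
    + (b21 * (a31 - s * a32 - s * a33) + b22 * (- t * a31 + a32 - s * a33)
      + b23 * (- t * a31 - t * a32 + a33))
    = x * (1 + s) * z + (y - x) * ((1 + s) * w - (1 + t) * z) + y * (1 + t) * w"
    unfolding a b x_def y_def z_def w_def by (simp add: algebra_simps)
  then have "x * (1 + s) * z + (y - x) * ((1 + s) * w - (1 + t) * z) + y * (1 + t) * w = - (1 + s)"
    unfolding e12 e13 e22 e23 by (simp add: algebra_simps)
  \<comment> \<open>Since \<open>(1 + t) * s = 1 + s\<close>, both sides carry the factor
    \<open>1 + t\<close>, which can be cancelled.\<close>
  moreover have "(1 + t) * (x * (1 + s) * z - s * x * w - y * z + y * (1 + s) * w)
    = x * (1 + s) * z + (y - x) * ((1 + s) * w - (1 + t) * z) + y * (1 + t) * w"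
    by (simp add: algebra_simps inverse_pair_simps[OF ts])
  moreover have "(1 + t) * (- s) = - (1 + s)" by (simp add: algebra_simps st)
  ultimately have "(1 + t) * (x * (1 + s) * z - s * x * w - y * z + y * (1 + s) * w) = (1 + t) * (- s)"
    by simp
  then show ?thesis using t unfolding mult_left_cancel[OF t] by (simp add: x_def y_def z_def w_def)
qed

text \<open>At \<open>t = -1\<close> the bar disappears and \<open>1 + s\<close> vanishes, so the
  relation for the divided form collapses to the determinant equation.\<close>

lemma det_spec:
  assumes A: "A \<in> Burau"
  shows "det (spec A) = 1"
proof -
  let ?a = "\<lambda>i j. A$i$j" and ?b = "\<lambda>i j. lbar (A$i$j)"
  note cl = Burau_entry[OF A] lbar_LP[OF Burau_entry[OF A]]
  have a: "?a i 2 = 1 - ?a i 1 - ?a i 3" for i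
    using Burau_row_sum[OF A, of i] by (simp add: algebra_simps)
  have b: "?b i 2 = 1 - ?b i 1 - ?b i 3" for i
    by (subst a) (simp add: bar.ev_simps LP_intros cl)
  have e: "?b i 1 * (?a j 1 - tinv * ?a j 2 - tinv * ?a j 3)
      + ?b i 2 * (- tt * ?a j 1 + ?a j 2 - tinv * ?a j 3)
      + ?b i 3 * (- tt * ?a j 1 - tt * ?a j 2 + ?a j 3) = J3$i$j" for i j
    by (subst Burau_fixes(3)[OF A, symmetric])
      (simp add: mbar_def matrix_matrix_mult_def transpose_def sum_3 J3_def algebra_simps)
  have J: "J3$1$2 = - tinv" "J3$1$3 = - tinv" "J3$2$2 = 1" "J3$2$3 = - tinv"
    by (simp_all add: J3_def)
  note form_on_differences[OF tinv_tt one_plus_tt_neq_0 b b a a e[of 1 2, unfolded J]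
      e[of 1 3, unfolded J] e[of 2 2, unfolded J] e[of 2 3, unfolded J]]
  from arg_cong[OF this, of evm] show ?thesis
    by (simp add: evm.ev_simps LP_intros cl evm_lbar det_2 spec_entries A algebra_simps)
qed

text \<open>At \<open>t = -1\<close> the relation for the first column reads
  \<open>- A11 + A21 - A31 = -1\<close>, and the hypothesis says that \<open>A21\<close> and
  \<open>A31\<close> agree there.\<close>

lemma evm_1_1:
  assumes A: "A \<in> Burau" and "spec A $2$1 = 0"
  shows "evm (A$1$1) = 1"
proof -
  have "evm (tt * A$1$1 + tt^2 * A$2$1 + tt^3 * A$3$1) = evm tt"
    by (simp only: Burau_weighted_column_sum[OF A])
  then show ?thesis
    using assms by (simp add: evm.ev_simps LP_intros Burau_entry spec_entries)
qed

text \<open>Divisibility of \<open>A11 - 1\<close> by \<open>1 + t\<close> makes both numerators of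
  the first row divisible. In the second row the factor \<open>1 + t\<close> in front of
  \<open>g21\<close> and \<open>g22\<close> cancels their denominators.\<close>

lemma phi_entry_LP:
  assumes A: "A \<in> Burau" and "evm (A$1$1) = 1"
  shows "phi A$i$j \<in> LP"
proof -
  have "evm (A$1$1 - 1) = 0" using assms by (simp add: evm.ev_simps Burau_entry LP_intros)
  then obtain q where q: "q \<in> LP" "A$1$1 - 1 = (1 + tt) * q"
    using one_plus_tt_dvd[of "A$1$1 - 1"] A by (auto intro: LP_intros Burau_entry)
  have gen: "x / t = 1 / t * x" "(1 + t) * x / (t * (1 + t)) = 1 / t * x"
    if "t \<noteq> 0" "1 + t \<noteq> 0" for t x :: "'a::field"
    using that by simp_all
  have d: "x / tt = tinv * x" and dd: "(1 + tt) * x / (tt * (1 + tt)) = tinv * x" for x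
    unfolding tinv_eq by (rule gen[OF tt_neq_0 one_plus_tt_neq_0])+
  have "A$1$1 * (1 + tt + tt^2) - 1 = (1 + tt) * (q * (1 + tt + tt^2) + tt)"
    using q(2) by (simp add: algebra_simps power2_eq_square)
  then have p11: "phi A$1$1 = tinv * (q * (1 + tt + tt^2) + tt)"
    by (simp only: phi_entries dd)
  have "A$1$1 + A$1$2 * (1 + tt) - 1 = (1 + tt) * (q + A$1$2)"
    using q(2) by (simp add: algebra_simps)
  then have p12: "phi A$1$2 = tinv * (q + A$1$2)"
    by (simp only: phi_entries dd)
  have 1: "phi A$1$1 \<in> LP" "phi A$1$2 \<in> LP"
    unfolding p11 p12 by (intro LP_intros q Burau_entry A)+
  have "phi A$2$1 \<in> LP" "phi A$2$2 \<in> LP"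
    unfolding phi_entries(3,4) d by (intro LP_intros 1 Burau_entry A)+
  with 1 show ?thesis using exhaust_2[of i] exhaust_2[of j] by auto
qed

section \<open>The Burau generators\<close>

text \<open>The Burau matrix of the first standard generator of the braid group on three strands;
  \<open>sig2\<close> is that of the second. At \<open>t = 1\<close> both become adjacent
  transpositions.\<close>

definition sig1 :: "K^3^3" where
  "sig1 = vector [vector [1 - tt, tt, 0], vector [1, 0, 0], vector [0, 0, 1]]"

definition sig2 :: "K^3^3" where
  "sig2 = vector [vector [1, 0, 0], vector [0, 1 - tt, tt], vector [0, 1, 0]]"

lemma lbar_gen: "lbar 0 = 0" "lbar 1 = 1" "lbar tt = tinv" "lbar (1 - tt) = 1 - tinv"
  by (simp_all add: bar.ev_simps LP_intros fls_X_inv_conv_shift_1)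

lemma ev1_gen: "ev1 0 = 0" "ev1 1 = 1" "ev1 tt = 1" "ev1 (1 - tt) = 0"
  by (simp_all add: ev1.ev_simps LP_intros)

lemma evm_gen: "evm 0 = 0" "evm 1 = 1" "evm tt = -1" "evm (1 - tt) = 2"
  by (simp_all add: evm.ev_simps LP_intros)

lemma transposition_matrix:
  assumes "a \<noteq> b"
  shows "permutation_matrix (\<chi> i j. if (if i = a then b else if i = b then a else i) = j then 1 else 0)"
proof -
  let ?p = "\<lambda>i. if i = a then b else if i = b then a else i"
  have "bij ?p" by (rule o_bij[of ?p]) (auto simp: fun_eq_iff assms)
  then have "?p permutes UNIV" by (intro bij_imp_permutes) auto
  then show ?thesis unfolding permutation_matrix_def by blast
qed

lemma sig1_Salter: "sig1 \<in> Salter"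
proof -
  let ?B = "vector [vector [0, 1, 0], vector [tinv, 1 - tinv, 0], vector [0, 0, 1]] :: K^3^3"
  have "GL_LP sig1"
    unfolding GL_LP_def
    by (intro conjI exI[of _ ?B])
      (simp_all add: mat_simps sig1_def LP_intros tt_tinv tinv_tt algebra_simps)
  moreover have "vB v* sig1 = vB" "sig1 *v ones3 = ones3"
    by (simp_all add: mat_simps sig1_def vB_def ones3_def algebra_simps power2_eq_square power3_eq_cube)
  moreover have "mbar sig1 ** J3 ** transpose sig1 = J3"
    by (simp add: mat_simps mbar_def J3_def) (simp add: sig1_def lbar_gen inverse_pair_simps[OF tt_tinv] algebra_simps)
  ultimately have "sig1 \<in> Burau" by (rule BurauI)
  moreover have "(\<chi> i j. ev1 (sig1$i$j)) = (\<chi> i j. if (if i = 1 then 2 else if i = 2 then 1 else i) = j then 1 else 0)"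
    by (simp add: vec_eq_iff forall_3 sig1_def ev1_gen)
  ultimately show ?thesis
    using transposition_matrix[of 1 "2::3"] by (simp add: Salter_def)
qed

lemma sig2_Salter: "sig2 \<in> Salter"
proof -
  let ?B = "vector [vector [1, 0, 0], vector [0, 0, 1], vector [0, tinv, 1 - tinv]] :: K^3^3"
  have "GL_LP sig2"
    unfolding GL_LP_def
    by (intro conjI exI[of _ ?B])
      (simp_all add: mat_simps sig2_def LP_intros tt_tinv tinv_tt algebra_simps)
  moreover have "vB v* sig2 = vB" "sig2 *v ones3 = ones3"
    by (simp_all add: mat_simps sig2_def vB_def ones3_def algebra_simps power2_eq_square power3_eq_cube)
  moreover have "mbar sig2 ** J3 ** transpose sig2 = J3"
    by (simp add: mat_simps mbar_def J3_def) (simp add: sig2_def lbar_gen inverse_pair_simps[OF tt_tinv] algebra_simps)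
  ultimately have "sig2 \<in> Burau" by (rule BurauI)
  moreover have "(\<chi> i j. ev1 (sig2$i$j)) = (\<chi> i j. if (if i = 2 then 3 else if i = 3 then 2 else i) = j then 1 else 0)"
    by (simp add: vec_eq_iff forall_3 sig2_def ev1_gen)
  ultimately show ?thesis
    using transposition_matrix[of 2 "3::3"] by (simp add: Salter_def)
qed

lemma spec_sig:
  "spec sig1 = vector [vector [1, 0], vector [1, 1]]"
  "spec sig2 = vector [vector [1, -1], vector [0, 1]]"
  using Salter_Burau[OF sig1_Salter] Salter_Burau[OF sig2_Salter]
  by (simp_all add: vec_eq_iff forall_2 spec_entries) (simp_all add: sig1_def sig2_def evm_gen)

text \<open>Here \<open>d = 1 + t\<close> and \<open>u\<close> is its inverse, so that only polynomial identities remain.\<close>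
lemma
  fixes d u :: "'a::comm_ring_1"
  assumes du: "d * u = 1" and t: "t = d - 1"
    and W: "W = (vector [vector [t + t^2, 0], vector [-1, t], vector [-1, -1]] :: 'a^2^3)"
    and X: "X = (vector [vector [- (t^2) * u, t * u], vector [(1 + t + t^2) * u, u]] :: 'a^2^2)"
    and Y: "Y = (vector [vector [1, 0], vector [0, - t]] :: 'a^2^2)"
  shows reduced_burau_intertwine:
      "vector [vector [1 - t, t, 0], vector [1, 0, 0], vector [0, 0, 1]] ** W = W ** X"
      "vector [vector [1, 0, 0], vector [0, 1 - t, t], vector [0, 1, 0]] ** W = W ** Y"
    and reduced_burau_order:
      "(X ** Y) ** ((X ** Y) ** (X ** Y)) = mat (t^3)"
      "(X ** Y ** X) ** (X ** Y ** X) = mat (t^3)"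
proof -
  have XY: "X ** Y = vector [vector [- (t^2) * u, - (t^2) * u], vector [(1 + t + t^2) * u, - t * u]]"
    by (simp add: mat_simps X Y algebra_simps power2_eq_square)
  have XYXY: "(X ** Y) ** (X ** Y) = vector [vector [- (t^2) * u, t^3 * u], vector [- t * (1 + t + t^2) * u, - (t^3) * u]]"
    unfolding XY by (simp add: mat_simps t inverse_pair_simps[OF du] algebra_simps power2_eq_square power3_eq_cube)
  show "(X ** Y) ** ((X ** Y) ** (X ** Y)) = mat (t^3)"
    unfolding XYXY unfolding XY
    by (simp add: mat_simps t inverse_pair_simps[OF du] algebra_simps power2_eq_square power3_eq_cube)
  have XYX: "X ** Y ** X = vector [vector [- (t^2) * u, - (t^2) * u], vector [- t * (1 + t + t^2) * u, t^2 * u]]"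
    unfolding XY unfolding X
    by (simp add: mat_simps t inverse_pair_simps[OF du] algebra_simps power2_eq_square power3_eq_cube)
  show "(X ** Y ** X) ** (X ** Y ** X) = mat (t^3)"
    unfolding XYX
    by (simp add: mat_simps t inverse_pair_simps[OF du] algebra_simps power2_eq_square power3_eq_cube)
qed (simp_all add: mat_simps W X Y t inverse_pair_simps[OF du] algebra_simps power2_eq_square power3_eq_cube)

text \<open>Verifying the intertwining relation and cancelling \<open>kerv_basis\<close> avoids
  computing with the quotients that define \<open>phi\<close>.\<close>

lemma phi_sig:
  "phi sig1 = vector [vector [- (tt^2) * (1 / (1 + tt)), tt * (1 / (1 + tt))],
     vector [(1 + tt + tt^2) * (1 / (1 + tt)), 1 / (1 + tt)]]" (is "_ = ?X")
  "phi sig2 = vector [vector [1, 0], vector [0, - tt]]" (is "_ = ?Y")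
proof -
  have du: "(1 + tt) * (1 / (1 + tt)) = 1" using one_plus_tt_neq_0 by simp
  note i = reduced_burau_intertwine[OF du _ kerv_basis_def refl refl, folded sig1_def sig2_def]
  show "phi sig1 = ?X"
    by (rule kerv_basis_cancel)
      (simp only: Burau_kerv_basis[symmetric] Salter_Burau sig1_Salter i add_diff_cancel_left')
  show "phi sig2 = ?Y"
    by (rule kerv_basis_cancel)
      (simp only: Burau_kerv_basis[symmetric] Salter_Burau sig2_Salter i add_diff_cancel_left')
qed

text \<open>Both words represent the full twist, which generates the center of the braid group on
  three strands; it acts by a scalar.\<close>

lemma phi_sig_order:
  "phi ((sig1 ** sig2) ** ((sig1 ** sig2) ** (sig1 ** sig2))) = mat (tt^3)"
  "phi ((sig1 ** sig2 ** sig1) ** (sig1 ** sig2 ** sig1)) = mat (tt^3)"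
proof -
  have du: "(1 + tt) * (1 / (1 + tt)) = 1" using one_plus_tt_neq_0 by simp
  note o = reduced_burau_order[OF du _ refl phi_sig]
  show "phi ((sig1 ** sig2) ** ((sig1 ** sig2) ** (sig1 ** sig2))) = mat (tt^3)"
    "phi ((sig1 ** sig2 ** sig1) ** (sig1 ** sig2 ** sig1)) = mat (tt^3)"
    using o by (simp_all only: phi_mult Burau_mult Salter_Burau sig1_Salter sig2_Salter add_diff_cancel_left')
qed

section \<open>The modular group\<close>

abbreviation matS :: "int^2^2" where "matS \<equiv> vector [vector [0, -1], vector [1, 0]]"
abbreviation lowerU :: "int \<Rightarrow> int^2^2" where "lowerU n \<equiv> vector [vector [1, 0], vector [n, 1]]"
abbreviation upperU :: "int \<Rightarrow> int^2^2" where "upperU n \<equiv> vector [vector [1, n], vector [0, 1]]"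

text \<open>This is Euclid's algorithm on the first row: right multiplication by elementary matrices
  performs column operations that lower the sum of absolute values.\<close>

lemma SL2Z_generated:
  assumes one: "mat 1 \<in> I" and mult: "\<And>X Y. X \<in> I \<Longrightarrow> Y \<in> I \<Longrightarrow> X ** Y \<in> I"
    and S: "matS \<in> I" and L: "lowerU 1 \<in> I" "lowerU (-1) \<in> I"
    and U: "upperU 1 \<in> I" "upperU (-1) \<in> I"
    and M: "det M = 1"
  shows "M \<in> I"
proof -
  have cancel: "M \<in> I" if "M ** X \<in> I" "X ** Y = mat 1" "Y \<in> I" for M X Y
    using mult[OF that(1,3)] that(2) by (simp flip: matrix_mul_assoc)
  have SS: "- mat 1 \<in> I"
  proof -
    have "matS ** matS = - mat 1" by (simp add: mat_simps)
    then show ?thesis using mult[OF S S] by simp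
  qed
  have low: "lowerU n \<in> I" for n
  proof (induction n rule: int_induct[of _ 0])
    case base
    have "lowerU 0 = mat 1" by (simp add: mat_simps)
    then show ?case using one by simp
  next
    case (step1 n)
    have "lowerU n ** lowerU 1 = lowerU (n + 1)" by (simp add: mat_simps)
    then show ?case using mult[OF step1(2) L(1)] by simp
  next
    case (step2 n)
    have "lowerU n ** lowerU (-1) = lowerU (n - 1)" by (simp add: mat_simps)
    then show ?case using mult[OF step2(2) L(2)] by simp
  qed
  have tri: "M \<in> I" if d: "det M = 1" and z: "M$1$2 = 0" for M
  proof -
    have "M$1$1 * M$2$2 = 1" using d z by (simp add: det_2)
    then consider "M$1$1 = 1" "M$2$2 = 1" | "M$1$1 = -1" "M$2$2 = -1"
      by (auto simp: zmult_eq_1_iff)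
    then show ?thesis
    proof cases
      case 1
      then have "M = lowerU (M$2$1)" using z by (simp add: vec_eq_iff forall_2)
      then show ?thesis using low by metis
    next
      case 2
      then have "M = - mat 1 ** lowerU (- (M$2$1))" using z by (simp add: mat_simps)
      then show ?thesis using mult[OF SS low] by metis
    qed
  qed
  have det: "det (M ** X) = 1" if "det M = 1" "det X = 1" for M X :: "int^2^2"
    using that by (simp add: det_mul)
  show ?thesis
    using M
  proof (induction "nat (\<bar>M$1$1\<bar> + \<bar>M$1$2\<bar>)" arbitrary: M rule: less_induct)
    case less
    have red: "M \<in> I" if "nat (\<bar>(M ** X)$1$1\<bar> + \<bar>(M ** X)$1$2\<bar>) < nat (\<bar>M$1$1\<bar> + \<bar>M$1$2\<bar>)"
      "det X = 1" "X ** Y = mat 1" "Y \<in> I" for X Y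
      by (rule cancel[OF less(1)[OF that(1) det[OF less(2) that(2)]] that(3,4)])
    show ?case
    proof (cases "M$1$2 = 0")
      case True
      then show ?thesis using tri less(2) by blast
    next
      case b: False
      show ?thesis
      proof (cases "M$1$1 = 0")
        case True
        \<comment> \<open>\<open>matS\<close> exchanges the columns up to sign and so moves the zero
          to the upper right corner.\<close>
        have "M ** matS \<in> I"
          using True by (intro tri det less(2)) (simp_all add: det_2 mat_simps)
        moreover have "matS ** (- mat 1 ** matS) = mat 1" by (simp add: mat_simps)
        ultimately show ?thesis using mult[OF SS S] by (rule cancel)
      next
        case a: False
        \<comment> \<open>For opposite signs the sum, and for equal signs the difference, is smaller
          in absolute value than the larger entry.\<close>
        consider "\<bar>M$1$1 + M$1$2\<bar> < \<bar>M$1$1\<bar>" | "\<bar>M$1$1 - M$1$2\<bar> < \<bar>M$1$1\<bar>"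
          | "\<bar>M$1$1 + M$1$2\<bar> < \<bar>M$1$2\<bar>" | "\<bar>M$1$2 - M$1$1\<bar> < \<bar>M$1$2\<bar>"
          using a b by linarith
        then show ?thesis
        proof cases
          case 1
          then show ?thesis
            by (intro red[of "lowerU 1" "lowerU (-1)"] L) (simp_all add: mat_simps det_2)
        next
          case 2
          then show ?thesis
            by (intro red[of "lowerU (-1)" "lowerU 1"] L) (simp_all add: mat_simps det_2)
        next
          case 3
          then show ?thesis
            by (intro red[of "upperU 1" "upperU (-1)"] U) (simp_all add: mat_simps det_2)
        next
          case 4
          then show ?thesis
            by (intro red[of "upperU (-1)" "upperU 1"] U) (simp_all add: mat_simps det_2)
        qed
      qed
    qed
  qed
qed

lemma SL2Z_simps [simp]:
  "carrier SL2Z = {A. det A = 1}" "x \<otimes>\<^bsub>SL2Z\<^esub> y = x ** y" "\<one>\<^bsub>SL2Z\<^esub> = mat 1"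
  by (simp_all add: SL2Z_def)

lemma group_SL2Z: "group SL2Z"
proof (rule groupI)
  fix x assume "x \<in> carrier SL2Z"
  then have d: "x$1$1 * x$2$2 - x$1$2 * x$2$1 = 1" by (simp add: det_2)
  let ?y = "vector [vector [x$2$2, - x$1$2], vector [- x$2$1, x$1$1]] :: int^2^2"
  have "?y ** x = mat 1" "det ?y = 1"
    using d by (simp_all add: mat_simps det_2 algebra_simps)
  then show "\<exists>y\<in>carrier SL2Z. y \<otimes>\<^bsub>SL2Z\<^esub> x = \<one>\<^bsub>SL2Z\<^esub>" by auto
qed (auto simp: det_mul matrix_mul_assoc)

interpretation SL2Z: group SL2Z
  by (rule group_SL2Z)

lemma neg_mat_1_mult:
  "- mat 1 ** M = (- M :: int^2^2)" "M ** - mat 1 = (- M :: int^2^2)"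
  by (simp_all add: mat_simps)

lemma normal_plus_minus_1: "{mat 1, - mat 1} \<lhd> SL2Z"
proof -
  have "- mat 1 ** - mat 1 = (mat 1 :: int^2^2)" by (simp add: neg_mat_1_mult)
  moreover have "det (- mat 1 :: int^2^2) = 1" by (simp add: det_2 mat_def)
  moreover have "inv\<^bsub>SL2Z\<^esub> (- mat 1) = - mat 1"
    using calculation by (intro SL2Z.inv_equality) auto
  ultimately have "subgroup {mat 1, - mat 1} SL2Z"
    using SL2Z.inv_one by (intro SL2Z.subgroupI) auto
  moreover have "x ** - mat 1 ** y = - mat 1 ** (x ** y)" for x y :: "int^2^2"
    by (simp add: mat_simps)
  ultimately show ?thesis
    using SL2Z.r_inv by (auto simp: SL2Z.normal_inv_iff)
qed

lemma group_PSL2Z: "group PSL2Z"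
  unfolding PSL2Z_def by (rule normal.factorgroup_is_group[OF normal_plus_minus_1])

definition toPSL :: "K^3^3 \<Rightarrow> (int^2^2) set" where
  "toPSL A = {mat 1, - mat 1} #>\<^bsub>SL2Z\<^esub> spec A"

lemma toPSL_hom: "toPSL \<in> hom Salter_grp PSL2Z"
proof -
  have h: "spec \<in> hom Salter_grp SL2Z"
    by (auto intro!: homI simp: spec_mult det_spec Salter_Burau)
  have "toPSL = (\<lambda>M. {mat 1, - mat 1} #>\<^bsub>SL2Z\<^esub> M) \<circ> spec"
    by (rule ext) (simp only: toPSL_def o_apply)
  then show ?thesis
    using hom_compose[OF h normal.r_coset_hom_Mod[OF normal_plus_minus_1]] by (simp only: PSL2Z_def)
qed

lemma toPSL_eq_one_iff:
  assumes "A \<in> Burau"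
  shows "toPSL A = \<one>\<^bsub>PSL2Z\<^esub> \<longleftrightarrow> spec A \<in> {mat 1, - mat 1}"
proof -
  have "subgroup {mat 1, - mat 1} SL2Z" by (rule normal_imp_subgroup[OF normal_plus_minus_1])
  moreover have "spec A \<in> carrier SL2Z" using det_spec[OF assms] by simp
  moreover have "\<one>\<^bsub>PSL2Z\<^esub> = {mat 1, - mat 1}" by (simp add: PSL2Z_def FactGroup_def)
  ultimately show ?thesis
    unfolding toPSL_def
    using SL2Z.coset_join1 SL2Z.coset_join2 subgroup.subset by metis
qed

section \<open>The projective linear group\<close>

lemma GL2K_simps [simp]:
  "carrier GL2K = {A. invertible A}" "x \<otimes>\<^bsub>GL2K\<^esub> y = x ** y" "\<one>\<^bsub>GL2K\<^esub> = mat 1"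
  by (simp_all add: GL2K_def)

lemma group_GL2K: "group GL2K"
proof (rule groupI)
  fix x assume "x \<in> carrier GL2K"
  then obtain y where "x ** y = mat 1" "y ** x = mat 1" by (auto simp: invertible_def)
  then show "\<exists>y\<in>carrier GL2K. y \<otimes>\<^bsub>GL2K\<^esub> x = \<one>\<^bsub>GL2K\<^esub>" by (auto simp: invertible_def)
qed (auto simp: matrix_mul_assoc invertible_mult, auto simp: invertible_def)

interpretation GL2K: group GL2K
  by (rule group_GL2K)

lemma mat_mult_mat: "mat c ** mat d = (mat (c * d) :: K^2^2)"
  by (simp add: mat_simps)

lemma mat_commute: "A ** mat c = mat c ** (A :: K^2^2)"
  by (simp add: mat_simps mult.commute)

lemma normal_scalars2: "scalars2 \<lhd> GL2K"
proof -
  have c: "mat c ** mat (inverse c) = (mat 1 :: K^2^2)" "mat (inverse c) ** mat c = (mat 1 :: K^2^2)"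
    if "c \<noteq> 0" for c using that by (simp_all add: mat_mult_mat)
  then have inv: "invertible (mat c :: K^2^2)" if "c \<noteq> 0" for c
    using that unfolding invertible_def by blast
  have i: "inv\<^bsub>GL2K\<^esub> (mat c) = mat (inverse c)" if "c \<noteq> 0" for c
    using that c inv by (intro GL2K.inv_equality) auto
  have I: "mat c \<in> scalars2" if "c \<noteq> 0" for c using that unfolding scalars2_def by blast
  have E: "\<exists>c. c \<noteq> 0 \<and> x = mat c" if "x \<in> scalars2" for x using that unfolding scalars2_def by blast
  have "subgroup scalars2 GL2K"
  proof (rule GL2K.subgroupI)
    show "scalars2 \<noteq> {}" using I[OF one_neq_zero] by force
    show "scalars2 \<subseteq> carrier GL2K" using E inv by fastforce
    fix a b assume a: "a \<in> scalars2"
    then obtain c where c: "c \<noteq> 0" "a = mat c" using E by blast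
    then show "inv\<^bsub>GL2K\<^esub> a \<in> scalars2" using i I[of "inverse c"] by simp
    assume b: "b \<in> scalars2"
    then obtain d where "d \<noteq> 0" "b = mat d" using E by blast
    then show "a \<otimes>\<^bsub>GL2K\<^esub> b \<in> scalars2" using c I[of "c * d"] by (simp add: mat_mult_mat)
  qed
  moreover have "x \<otimes>\<^bsub>GL2K\<^esub> h \<otimes>\<^bsub>GL2K\<^esub> inv\<^bsub>GL2K\<^esub> x \<in> scalars2"
    if x: "x \<in> carrier GL2K" and h: "h \<in> scalars2" for x h
  proof -
    obtain c where "c \<noteq> 0" "h = mat c" using E[OF h] by blast
    then have "x ** h ** inv\<^bsub>GL2K\<^esub> x = h ** (x ** inv\<^bsub>GL2K\<^esub> x)"
      by (simp add: mat_commute matrix_mul_assoc)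
    also have "x ** inv\<^bsub>GL2K\<^esub> x = mat 1" using GL2K.r_inv[OF x] by simp
    finally show ?thesis using h by simp
  qed
  ultimately show ?thesis unfolding GL2K.normal_inv_iff by blast
qed

lemma group_PGL2K: "group PGL2K"
  unfolding PGL2K_def by (rule normal.factorgroup_is_group[OF normal_scalars2])

lemma phi_invertible:
  assumes A: "A \<in> Burau"
  shows "invertible (phi A)"
proof -
  obtain B where B: "B \<in> Burau" "A ** B = mat 1" "B ** A = mat 1" using Burau_inverse[OF A] .
  then show ?thesis
    unfolding invertible_def using phi_mult[OF A B(1)] phi_mult[OF B(1) A] phi_mat_1 by metis
qed

lemma phibar_hom: "phibar \<in> hom Salter_grp PGL2K"
proof -
  have h: "phi \<in> hom Salter_grp GL2K"
    by (auto intro!: homI simp: phi_mult phi_invertible Salter_Burau)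
  have "phibar = (\<lambda>M. scalars2 #>\<^bsub>GL2K\<^esub> M) \<circ> phi"
    by (rule ext) (simp only: phibar_def proj_def o_apply)
  then show ?thesis
    using hom_compose[OF h normal.r_coset_hom_Mod[OF normal_scalars2]] by (simp only: PGL2K_def)
qed

lemma phibar_eq_one_iff:
  assumes "A \<in> Burau"
  shows "phibar A = \<one>\<^bsub>PGL2K\<^esub> \<longleftrightarrow> (\<exists>c. phi A = mat c)"
proof -
  have "subgroup scalars2 GL2K" by (rule normal_imp_subgroup[OF normal_scalars2])
  moreover have p: "phi A \<in> carrier GL2K" using phi_invertible[OF assms] by simp
  moreover have "\<one>\<^bsub>PGL2K\<^esub> = scalars2" by (simp add: PGL2K_def FactGroup_def)
  ultimately have "phibar A = \<one>\<^bsub>PGL2K\<^esub> \<longleftrightarrow> phi A \<in> scalars2"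
    unfolding phibar_def proj_def
    using GL2K.coset_join1 GL2K.coset_join2 subgroup.subset by metis
  also have "\<dots> \<longleftrightarrow> (\<exists>c. phi A = mat c)"
  proof -
    \<comment> \<open>Invertibility rules out \<open>c = 0\<close>, the only scalar matrix outside
      \<open>scalars2\<close>.\<close>
    have "phi A \<noteq> mat 0"
    proof
      assume "phi A = mat 0"
      then obtain B where "(mat 0 :: K^2^2) ** B = mat 1" using p by (auto simp: invertible_def)
      then show False by (simp add: mat_simps)
    qed
    then show ?thesis unfolding scalars2_def by auto
  qed
  finally show ?thesis .
qed

text \<open>The inverse of \<open>A\<close> also specialises to a sign. Both lower left entries
  vanish, so \<open>phi A\<close> and its inverse have Laurent polynomial entries.\<close>

lemma proj_phi_PGL2_LP:
  assumes A: "A \<in> Burau" and s: "spec A \<in> {mat 1, - mat 1}"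
  shows "phibar A \<in> PGL2_LP"
proof -
  obtain B where B: "B \<in> Burau" "A ** B = mat 1" "B ** A = mat 1" using Burau_inverse[OF A] .
  have "spec A ** spec B = mat 1" using spec_mult[OF A B(1)] B(2) spec_mat_1 by simp
  then have sB: "spec B \<in> {mat 1, - mat 1}"
    using s by (auto simp: neg_mat_1_mult minus_equation_iff)
  have e: "phi C$i$j \<in> LP" if "C \<in> Burau" "spec C \<in> {mat 1, - mat 1}" for C i j
    using that by (intro phi_entry_LP evm_1_1) (auto simp: mat_def)
  have "phi A ** phi B = mat 1" "phi B ** phi A = mat 1"
    using phi_mult[OF A B(1)] phi_mult[OF B(1) A] B phi_mat_1 by simp_all
  then have "GL_LP (phi A)"
    unfolding GL_LP_def using e[OF A s] e[OF B(1) sB] by blast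
  then show ?thesis unfolding PGL2_LP_def phibar_def by blast
qed

section \<open>The center of Salter's group\<close>

lemma phi_scalar_commutes:
  assumes "A \<in> Burau" "B \<in> Burau" "phi A = mat c"
  shows "A ** B = B ** A"
  by (rule phi_inj) (use assms in \<open>simp_all add: Burau_mult phi_mult mat_commute\<close>)

text \<open>\<open>phi sig2\<close> is diagonal with distinct entries \<open>1\<close> and
  \<open>-t\<close>, so \<open>phi A\<close> is diagonal; the nonzero upper right entry of
  \<open>phi sig1\<close> then equates its diagonal entries. Likewise an integer matrix commuting
  with \<open>spec sig1\<close> and \<open>spec sig2\<close> is scalar, and determinant one leaves
  only the signs.\<close>

lemma commutes_with_sig:
  assumes A: "A \<in> Burau" and c1: "A ** sig1 = sig1 ** A" and c2: "A ** sig2 = sig2 ** A"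
  shows "\<exists>c. phi A = mat c" and "spec A \<in> {mat 1, - mat 1}"
proof -
  note s = Salter_Burau[OF sig1_Salter] Salter_Burau[OF sig2_Salter]
  let ?p = "phi A"
  have c1': "?p ** phi sig1 = phi sig1 ** ?p" and c2': "?p ** phi sig2 = phi sig2 ** ?p"
    using c1 c2 A s by (simp_all flip: phi_mult)
  have "(?p ** phi sig2)$1$2 = - tt * ?p$1$2" "(phi sig2 ** ?p)$1$2 = ?p$1$2"
    "(?p ** phi sig2)$2$1 = ?p$2$1" "(phi sig2 ** ?p)$2$1 = - tt * ?p$2$1"
    unfolding phi_sig by (simp_all add: mat_simps)
  moreover have "y = 0" if "- tt * y = y" for y
  proof -
    have "(1 + tt) * y = y - - tt * y" by (simp add: distrib_right)
    then have "(1 + tt) * y = 0" unfolding that by simp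
    then show ?thesis using one_plus_tt_neq_0 by simp
  qed
  ultimately have off: "?p$1$2 = 0" "?p$2$1 = 0" using c2' by metis+
  have "(?p ** phi sig1)$1$2 = ?p$1$1 * (tt * (1 / (1 + tt)))"
    "(phi sig1 ** ?p)$1$2 = tt * (1 / (1 + tt)) * ?p$2$2"
    unfolding phi_sig using off by (simp_all add: mat_simps)
  then have "(tt * (1 / (1 + tt))) * ?p$1$1 = (tt * (1 / (1 + tt))) * ?p$2$2"
    using c1' by (simp only: mult.commute)
  then have "?p$1$1 = ?p$2$2"
    using tt_neq_0 one_plus_tt_neq_0
    by (metis divide_eq_0_iff mult_cancel_left mult_eq_0_iff zero_neq_one)
  then have "?p = mat (?p$1$1)" using off by (simp add: mat_simps)
  then show "\<exists>c. phi A = mat c" ..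
  let ?m = "spec A"
  have d1: "?m ** spec sig1 = spec sig1 ** ?m" and d2: "?m ** spec sig2 = spec sig2 ** ?m"
    using c1 c2 A s by (simp_all flip: spec_mult)
  from d1 d2 have m: "?m$1$2 = 0" "?m$2$1 = 0" "?m$1$1 = ?m$2$2"
    unfolding spec_sig by (auto simp: mat_simps)
  moreover have "?m$1$1 * ?m$1$1 = 1" using det_spec[OF A] m by (simp add: det_2)
  ultimately show "spec A \<in> {mat 1, - mat 1}"
    by (auto simp: mat_simps zmult_eq_1_iff)
qed

text \<open>Commuting with the Burau generators gives one inclusion, faithfulness of
  \<open>phi\<close> the other. The quotient by the center is thus the quotient by a kernel.\<close>

lemma center_Salter_grp: "center Salter_grp = kernel Salter_grp PGL2K phibar"
proof (intro equalityI subsetI)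
  fix A assume "A \<in> center Salter_grp"
  then have A: "A \<in> Salter" "A ** sig1 = sig1 ** A" "A ** sig2 = sig2 ** A"
    using sig1_Salter sig2_Salter by (auto simp: center_def)
  then show "A \<in> kernel Salter_grp PGL2K phibar"
    using commutes_with_sig(1) Salter_Burau by (simp add: kernel_def phibar_eq_one_iff)
next
  fix A assume "A \<in> kernel Salter_grp PGL2K phibar"
  then show "A \<in> center Salter_grp"
    using phi_scalar_commutes Salter_Burau by (auto simp: kernel_def center_def phibar_eq_one_iff)
qed

lemma center_spec: "A \<in> center Salter_grp \<Longrightarrow> spec A \<in> {mat 1, - mat 1}"
  using commutes_with_sig(2) sig1_Salter sig2_Salter Salter_Burau by (auto simp: center_def)

section \<open>The braid group as a complement\<close>

text \<open>\<open>braid_a\<close> is the half twist. The cube of \<open>braid_c\<close> and the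
  square of \<open>braid_a\<close> are both the full twist, whence orders 3 and 2 modulo the
  center.\<close>

definition braid_c :: "K^3^3" where "braid_c = sig1 ** sig2"
definition braid_a :: "K^3^3" where "braid_a = sig1 ** sig2 ** sig1"

lemma braid_Salter: "braid_a \<in> Salter" "braid_c \<in> Salter"
  by (simp_all add: braid_a_def braid_c_def Salter_mult sig1_Salter sig2_Salter)

lemma spec_braid:
  "spec braid_c = vector [vector [1, -1], vector [1, 0]]" "spec braid_a = matS"
  by (simp_all add: braid_a_def braid_c_def spec_mult Burau_mult Salter_Burau sig1_Salter sig2_Salter)
    (simp_all add: spec_sig mat_simps)

lemma braid_center:
  "braid_a ** braid_a \<in> center Salter_grp" "braid_c ** (braid_c ** braid_c) \<in> center Salter_grp"
proof -
  have "phi (braid_a ** braid_a) = mat (tt^3)" "phi (braid_c ** (braid_c ** braid_c)) = mat (tt^3)"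
    unfolding braid_a_def braid_c_def by (rule phi_sig_order)+
  then show "braid_a ** braid_a \<in> center Salter_grp" "braid_c ** (braid_c ** braid_c) \<in> center Salter_grp"
    using braid_Salter by (auto simp: center_Salter_grp kernel_def phibar_eq_one_iff Salter_mult Salter_Burau)
qed

text \<open>Ping-pong: a nonempty word in \<open>ac\<close> and \<open>ac\<^sup>2\<close> specialises, up to sign, to a positive word in
  two elementary matrices, whose off-diagonal entries are not both zero.\<close>
lemma spec_ac_words:
  assumes "p \<in> ac_words Salter_grp braid_a braid_c"
  shows "p \<in> Salter \<and> (\<exists>e\<in>{1,-1}. \<exists>x y z w. spec p = vector [vector [e * x, - e * y], vector [- e * z, e * w]]
    \<and> x \<ge> 1 \<and> w \<ge> 1 \<and> y \<ge> 0 \<and> z \<ge> 0 \<and> (p = mat 1 \<or> y + z \<ge> 1))"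
  using assms
proof induction
  case one
  have "spec (mat 1) = vector [vector [1 * 1, - 1 * 0], vector [- 1 * 0, 1 * 1]]"
    unfolding spec_mat_1 by (simp add: mat_simps)
  then show ?case
    using Salter_mat_1
    by (intro conjI bexI[of _ 1] exI[of _ 1] exI[of _ 0]) auto
next
  case (ac p)
  then obtain e x y z w where p: "p \<in> Salter" "e \<in> {1,-1}"
    "spec p = vector [vector [e * x, - e * y], vector [- e * z, e * w]]"
    "x \<ge> 1" "w \<ge> 1" "y \<ge> 0" "z \<ge> 0" by blast
  have "spec (p ** (braid_a ** braid_c)) = spec p ** (spec braid_a ** spec braid_c)"
    using p(1) braid_Salter by (simp add: spec_mult Burau_mult Salter_Burau)
  \<comment> \<open>The syllable \<open>ac\<close> specialises to \<open>- lowerU (-1)\<close>: the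
    sign goes into \<open>e\<close>, and \<open>z\<close> grows to
    \<open>z + w \<ge> 1\<close>.\<close>
  also have "\<dots> = vector [vector [- e * (x + y), - (- e) * y], vector [- (- e) * (z + w), - e * w]]"
    unfolding p spec_braid by (simp add: mat_simps algebra_simps)
  finally have "spec (p ** (braid_a ** braid_c)) = \<dots>" .
  moreover have "p ** (braid_a ** braid_c) \<in> Salter" using p(1) braid_Salter by (simp add: Salter_mult)
  ultimately show ?case
    using p
    by (intro conjI bexI[of _ "- e"] exI[of _ "x + y"] exI[of _ y] exI[of _ "z + w"] exI[of _ w]) auto
next
  case (acc p)
  then obtain e x y z w where p: "p \<in> Salter" "e \<in> {1,-1}"
    "spec p = vector [vector [e * x, - e * y], vector [- e * z, e * w]]"
    "x \<ge> 1" "w \<ge> 1" "y \<ge> 0" "z \<ge> 0" by blast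
  have "spec (p ** (braid_a ** (braid_c ** braid_c))) = spec p ** (spec braid_a ** (spec braid_c ** spec braid_c))"
    using p(1) braid_Salter by (simp add: spec_mult Burau_mult Salter_Burau)
  \<comment> \<open>The syllable \<open>acc\<close> specialises to \<open>- upperU (-1)\<close>, so
    \<open>y\<close> grows to \<open>x + y \<ge> 1\<close>.\<close>
  also have "\<dots> = vector [vector [- e * x, - (- e) * (x + y)], vector [- (- e) * z, - e * (z + w)]]"
    unfolding p spec_braid by (simp add: mat_simps algebra_simps)
  finally have "spec (p ** (braid_a ** (braid_c ** braid_c))) = \<dots>" .
  moreover have "p ** (braid_a ** (braid_c ** braid_c)) \<in> Salter"
    using p(1) braid_Salter by (simp add: Salter_mult)
  ultimately show ?case
    using p
    by (intro conjI bexI[of _ "- e"] exI[of _ x] exI[of _ "x + y"] exI[of _ z] exI[of _ "z + w"]) auto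
qed

text \<open>Since \<open>braid_a = braid_c ** sig1\<close>, this is also the subgroup generated by
  \<open>sig1\<close> and \<open>sig2\<close>; the generators chosen here suit the normal
  form.\<close>

definition braid_image :: "(K^3^3) set" where
  "braid_image = generate Salter_grp {braid_a, braid_c}"

lemma braid_image_subgroup: "subgroup braid_image Salter_grp"
  unfolding braid_image_def using braid_Salter by (intro Salter.generate_is_subgroup) auto

text \<open>In the normal form the central factor contributes only a sign. For each choice of outer
  letters, the signs of the entries of \<open>spec p\<close> let the off-diagonal entries vanish
  only if all other factors are trivial.\<close>

lemma braid_image_spec_trivial:
  assumes g: "g \<in> braid_image" and s: "spec g \<in> {mat 1, - mat 1}"
  shows "g \<in> center Salter_grp"
proof -
  have Z: "subgroup (center Salter_grp) Salter_grp"
    unfolding center_Salter_grp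
    by (intro group_hom.subgroup_kernel group_hom.intro group_hom_axioms.intro
        group_Salter_grp group_PGL2K phibar_hom)
  have central: "z ** h = h ** z" if "z \<in> center Salter_grp" "h \<in> Salter" for z h
    using that by (simp add: center_def)
  obtain l p r z where g: "g = l ** p ** r ** z" and l: "l \<in> {mat 1, braid_c, braid_c ** braid_c}"
    and p: "p \<in> ac_words Salter_grp braid_a braid_c" and r: "r \<in> {mat 1, braid_a}"
    and z: "z \<in> center Salter_grp"
    using Salter.generate_normal_form[of braid_a braid_c "center Salter_grp" g, unfolded Salter_grp_simps,
        OF braid_Salter Z central braid_center g[unfolded braid_image_def]] by blast
  obtain e x y u w where P: "p \<in> Salter" "e \<in> {1,-1}"
    "spec p = vector [vector [e * x, - e * y], vector [- e * u, e * w]]"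
    "x \<ge> 1" "w \<ge> 1" "y \<ge> 0" "u \<ge> 0" "p = mat 1 \<or> y + u \<ge> 1"
    using spec_ac_words[OF p] by blast
  have mem: "l \<in> Salter" "r \<in> Salter" "z \<in> Salter"
    using l r z braid_Salter by (auto simp: center_def Salter_mult Salter_mat_1)
  have "spec g = spec l ** spec p ** spec r ** spec z"
    using mem P(1) by (simp add: g spec_mult Burau_mult Salter_Burau)
  then have lpr: "spec l ** spec p ** spec r \<in> {mat 1, - mat 1}"
    using s center_spec[OF z] by (auto simp: neg_mat_1_mult minus_equation_iff)
  have cc: "spec (braid_c ** braid_c) = vector [vector [0, -1], vector [1, -1]]"
    using braid_Salter by (simp add: spec_mult Salter_Burau spec_braid) (simp add: mat_simps)
  have l': "spec l \<in> {mat 1, vector [vector [1, -1], vector [1, 0]], vector [vector [0, -1], vector [1, -1]]}"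
    using l by (auto simp: spec_mat_1 spec_braid cc)
  have r': "spec r \<in> {mat 1, matS}" using r by (auto simp: spec_mat_1 spec_braid)
  have off: "M$1$2 = 0 \<and> M$2$1 = 0" if "M \<in> {mat 1, - mat 1}" for M :: "int^2^2"
    using that by (auto simp: mat_def)
  have "y = 0 \<and> u = 0 \<and> spec l = mat 1 \<and> spec r = mat 1"
    using off[OF lpr] l' r' P(2,4-7) unfolding P(3) by (auto simp: mat_simps)
  \<comment> \<open>Every nontrivial choice of \<open>l\<close> or \<open>r\<close> specialises to a
    matrix with lower left entry \<open>1\<close>.\<close>
  moreover have "l = mat 1" if "spec l = mat 1"
    using arg_cong[OF that, of "\<lambda>M. M$2$1"] l by (auto simp: spec_braid cc mat_def[of "1::int"])
  moreover have "r = mat 1" if "spec r = mat 1"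
    using arg_cong[OF that, of "\<lambda>M. M$2$1"] r by (auto simp: spec_braid mat_def[of "1::int"])
  ultimately show ?thesis using P(8) z by (simp add: g)
qed

lemma braid_image_spec_surj:
  assumes "det M = 1"
  shows "M \<in> spec ` braid_image"
proof (rule SL2Z_generated[OF _ _ _ _ _ _ _ assms])
  interpret D: subgroup braid_image Salter_grp by (rule braid_image_subgroup)
  have in_Salter: "g \<in> Salter" if "g \<in> braid_image" for g using D.mem_carrier[OF that] by simp
  show "mat 1 \<in> spec ` braid_image" using D.one_closed spec_mat_1 by (metis Salter_grp_simps(3) imageI)
  show mult: "X ** Y \<in> spec ` braid_image" if XY: "X \<in> spec ` braid_image" "Y \<in> spec ` braid_image" for X Y
  proof -
    obtain g h where "g \<in> braid_image" "h \<in> braid_image" "X = spec g" "Y = spec h"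
      using XY unfolding image_iff by blast
    then have "X ** Y = spec (g ** h)" "g ** h \<in> braid_image"
      using D.m_closed[of g h] in_Salter by (simp_all add: spec_mult Salter_Burau)
    then show ?thesis by (rule image_eqI)
  qed
  have a: "braid_a \<in> braid_image" and c: "braid_c \<in> braid_image"
    unfolding braid_image_def by (auto intro: generate.incl)
  show S: "matS \<in> spec ` braid_image" using a spec_braid(2) by (metis imageI)
  have C: "vector [vector [1, -1], vector [1, 0]] \<in> spec ` braid_image" using c spec_braid(1) by (metis imageI)
  note m = mult[OF S C] mult[OF S mult[OF C C]]
  \<comment> \<open>This is \<open>- mat 1\<close>; it corrects the signs of the words
    \<open>SC\<close>, \<open>SCC\<close>, \<open>CCS\<close> and \<open>CS\<close>, which give the
    four elementary matrices.\<close>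
  note S2 = mult[OF S S]
  show "lowerU (-1) \<in> spec ` braid_image"
    using mult[OF S2 m(1)] by (rule back_subst[of "\<lambda>X. X \<in> _"]) (simp add: mat_simps)
  show "upperU (-1) \<in> spec ` braid_image"
    using mult[OF S2 m(2)] by (rule back_subst[of "\<lambda>X. X \<in> _"]) (simp add: mat_simps)
  show "lowerU 1 \<in> spec ` braid_image"
    using mult[OF mult[OF S2 mult[OF C C]] S] by (rule back_subst[of "\<lambda>X. X \<in> _"]) (simp add: mat_simps)
  show "upperU 1 \<in> spec ` braid_image"
    using mult[OF mult[OF S2 C] S] by (rule back_subst[of "\<lambda>X. X \<in> _"]) (simp add: mat_simps)
qed

theorem theorem3p17:
  shows "\<exists>F. subgroup F PGL2K \<and> F \<subseteq> phibar ` Burau \<inter> PGL2_LP \<and>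
           (\<exists>\<theta>. semidirect_action (PGL2K\<lparr>carrier := F\<rparr>) PSL2Z \<theta> \<and>
                Salter_grp Mod center Salter_grp \<cong> semidirect_product (PGL2K\<lparr>carrier := F\<rparr>) PSL2Z \<theta>)"
proof -
  \<comment> \<open>\<open>F\<close> consists of the classes of \<open>phi A\<close> for those
    \<open>A\<close> in Salter's group that specialise to a sign.\<close>
  let ?F = "phibar ` kernel Salter_grp PSL2Z toPSL"
  interpret D: subgroup braid_image Salter_grp by (rule braid_image_subgroup)
  have D: "g \<in> Salter" if "g \<in> braid_image" for g using D.mem_carrier[OF that] by simp
  have surj: "toPSL ` braid_image = carrier PSL2Z"
  proof (intro equalityI subsetI)
    fix q assume "q \<in> toPSL ` braid_image"
    then show "q \<in> carrier PSL2Z" using hom_in_carrier[OF toPSL_hom] D by auto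
  next
    fix q assume "q \<in> carrier PSL2Z"
    then obtain M where M: "det M = 1" "q = {mat 1, - mat 1} #>\<^bsub>SL2Z\<^esub> M"
      by (auto simp: PSL2Z_def FactGroup_def RCOSETS_def)
    then show "q \<in> toPSL ` braid_image"
      using braid_image_spec_surj[OF M(1)] unfolding toPSL_def by auto
  qed
  \<comment> \<open>The ping-pong argument puts such an element into the center, which is the kernel
    of \<open>phibar\<close>.\<close>
  have triv: "phibar d = \<one>\<^bsub>PGL2K\<^esub>" if "d \<in> braid_image" "toPSL d = \<one>\<^bsub>PSL2Z\<^esub>" for d
    using braid_image_spec_trivial[OF that(1)] that(2) toPSL_eq_one_iff[OF Salter_Burau[OF D[OF that(1)]]]
    by (auto simp: center_Salter_grp kernel_def)
  \<comment> \<open>Central elements commute with both Burau generators and therefore specialise to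
    a sign.\<close>
  have ker: "kernel Salter_grp PGL2K phibar \<subseteq> kernel Salter_grp PSL2Z toPSL"
  proof
    fix A assume A: "A \<in> kernel Salter_grp PGL2K phibar"
    then have "spec A \<in> {mat 1, - mat 1}" using center_spec center_Salter_grp by blast
    then show "A \<in> kernel Salter_grp PSL2Z toPSL"
      using A by (simp add: kernel_def toPSL_eq_one_iff Salter_Burau)
  qed
  note semi = semidirect_of_section[OF group_Salter_grp group_PGL2K group_PSL2Z phibar_hom toPSL_hom
      braid_image_subgroup surj triv ker]
  have "?F \<subseteq> phibar ` Burau \<inter> PGL2_LP"
    using proj_phi_PGL2_LP toPSL_eq_one_iff Salter_Burau by (auto simp: kernel_def)
  then show ?thesis
    using semi unfolding center_Salter_grp by blast
qed

end
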